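(* Let $d\in\mathbb{N}$. (1) If $(X,T)$ is a minimal distal system, then the maximal $(d-1)$-step pro-nilfactor $Z_{d-1}$ of $(X,T)$ (with its factor map $X\to Z_{d-1}$) is the topological cubic characteristic factor of order $d$ of $(X,T)$. (2) If $(X,T)$ is a minimal weakly mixing system, then the trivial (one-point) system is the topological cubic characteristic factor of order $d$ of $(X,T)$.
   Context: A (topological dynamical) system $(X,T)$ is a compact metric space $X$ with metric $\rho$ and a homeomorphism $T:X\to X$; the letter $T$ is used for the transformation of every system. It is minimal if every orbit $\{T^nx:n\in\mathbb{Z}\}$ is dense. It is transitive if for all nonempty open $U,V\subseteq X$ there is $n\in\mathbb{Z}$ with $U\cap T^{-n}V\ne\emptyset$, and weakly mixing if $(X\times X,T\times T)$ is transitive. It is distal if $\inf_{n\in\mathbb{Z}}\rho(T^nx,T^ny)>0$ whenever $x\ne y$. A factor map $\pi:(X,T)\to(Y,T)$ is a continuous surjection with $\pi T=T\pi$. For $d\ge1$, $X^{[d]}=X^{2^d}$ with points $\mathbf{x}=(x_\epsilon)_{\epsilon\in\{0,1\}^d}$, and the first coordinate is $x_{\mathbf 0}$, where $\mathbf 0=(0,\ldots,0)$. For $\mathbf n\in\mathbb{Z}^d$ and $\epsilon\in\{0,1\}^d$, $\mathbf n\cdot\epsilon=\sum_i n_i\epsilon_i$. For $x\in X$, $x^{[d]}=(x,\ldots,x)\in X^{[d]}$. The face transformations $T^{[d]}_j$ ($1\le j\le d$) of $X^{[d]}$ are given by $(T^{[d]}_j\mathbf{x})_\epsilon=Tx_\epsilon$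 if $\epsilon_j=1$ and $(T^{[d]}_j\mathbf{x})_\epsilon=x_\epsilon$ if $\epsilon_j=0$. The face group $\mathcal{F}^{[d]}$ is the group generated by $T^{[d]}_1,\ldots,T^{[d]}_d$. For $k\ge1$, $\mathbf{RP}^{[k]}(X,T)$ is the set of $(x,y)\in X^2$ such that for every $\delta>0$ there are $x',y'\in X$ and $\mathbf n\in\mathbb{Z}^k$ with $\rho(x,x')<\delta$, $\rho(y,y')<\delta$ and $\rho(T^{\mathbf n\cdot\epsilon}x',T^{\mathbf n\cdot\epsilon}y')<\delta$ for all $\epsilon\in\{0,1\}^k\setminus\{\mathbf 0\}$. For minimal $(X,T)$ this is a closed invariant equivalence relation, and $Z_k=X/\mathbf{RP}^{[k]}(X,T)$ with the induced action is the maximal $k$-step pro-nilfactor of $(X,T)$ (the maximal factor that is an inverse limit of $k$-step minimal nilsystems). $Z_0$ is the trivial one-point system. Let $\pi:(X,T)\to(Y,T)$ be a factor map. $(Y,T)$ is a topological cubic characteristic factor of order $d$ of $(X,T)$ if there is a dense $G_\delta$ set $X_0\subseteq X$ such that for each $x\in X_0$ the set $F_x=p_*\big(\overline{\mathcal{F}^{[d]}x^{[d]}}\big)\subseteq X^{2^d-1}$ is saturated for $\pi^{2^d-1}=\pi\times\cdots\times\pi$ ($2^d-1$ times), i.e. $F_x=(\pi^{2^d-1})^{-1}(\pi^{2^d-1}(F_x))$, where $p_*:X^{2^d}\to X^{2^d-1}$ is the projection forgetting the coordinate $x_{\mathbf 0}$. Equivalently, $\overline{\mathcal{F}^{[d]}x^{[d]}}=\{x\}\times(\pi^{2^d-1})^{-1}(\pi^{2^d-1}(F_x))$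 for each $x\in X_0$. *)

theory Defs
  imports "HOL-Analysis.Analysis" "HOL-Algebra.Bij" "HOL-Algebra.Generated_Groups"
begin

section \<open>Dynamical systems and factor maps\<close>

text \<open>
  Systems are given by a topology, so that factors, which are quotient spaces, are systems in the
  same sense. The system \<open>X\<close> whose factors are studied lives on a whole type of class
  \<open>metric_space\<close>, with topology \<open>euclidean\<close> and metric \<open>dist\<close>.
\<close>

definition dynamical_system :: "'a topology \<Rightarrow> ('a \<Rightarrow> 'a) \<Rightarrow> bool" where
  "dynamical_system X T \<longleftrightarrow>
     compact_space X \<and> metrizable_space X \<and> homeomorphic_map X X T"

definition factor_map ::
    "'a topology \<Rightarrow> ('a \<Rightarrow> 'a) \<Rightarrow> 'b topology \<Rightarrow> ('b \<Rightarrow> 'b) \<Rightarrow> ('a \<Rightarrow> 'b) \<Rightarrow> bool" where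
  "factor_map X T Y S \<pi> \<longleftrightarrow>
     dynamical_system X T \<and> dynamical_system Y S \<and>
     continuous_map X Y \<pi> \<and> \<pi> ` topspace X = topspace Y \<and>
     (\<forall>x\<in>topspace X. \<pi> (T x) = S (\<pi> x))"

text \<open>The iterate \<open>T\<^sup>n\<close> of a bijection for an integer \<open>n\<close>.\<close>

definition int_iter :: "('a \<Rightarrow> 'a) \<Rightarrow> int \<Rightarrow> 'a \<Rightarrow> 'a" where
  "int_iter T n = (if 0 \<le> n then T ^^ nat n else inv_into UNIV T ^^ nat (- n))"

definition minimal_system :: "('a::topological_space \<Rightarrow> 'a) \<Rightarrow> bool" where
  "minimal_system T \<longleftrightarrow> (\<forall>x. closure (range (\<lambda>n. int_iter T n x)) = UNIV)"

definition transitive_system :: "('a::topological_space \<Rightarrow> 'a) \<Rightarrow> bool" where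
  "transitive_system T \<longleftrightarrow>
     (\<forall>U V. open U \<longrightarrow> open V \<longrightarrow> U \<noteq> {} \<longrightarrow> V \<noteq> {} \<longrightarrow> (\<exists>n. U \<inter> int_iter T n -` V \<noteq> {}))"

definition weakly_mixing :: "('a::topological_space \<Rightarrow> 'a) \<Rightarrow> bool" where
  "weakly_mixing T \<longleftrightarrow> transitive_system (map_prod T T)"

definition distal :: "('a::metric_space \<Rightarrow> 'a) \<Rightarrow> bool" where
  "distal T \<longleftrightarrow>
     (\<forall>x y. x \<noteq> y \<longrightarrow> 0 < (INF n. dist (int_iter T n x) (int_iter T n y)))"


section \<open>Cubes and the face group\<close>

text \<open>
  Elements of \<open>{0,1}\<^sup>d\<close> are extensional functions on \<open>{1..d}\<close>, and points of \<open>X\<^sup>[\<^sup>d\<^sup>]\<close> are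
  extensional functions on \<open>{0,1}\<^sup>d\<close>.
\<close>

definition cube :: "nat \<Rightarrow> (nat \<Rightarrow> int) set" where
  "cube d = {1..d} \<rightarrow>\<^sub>E {0, 1}"

definition cube_zero :: "nat \<Rightarrow> nat \<Rightarrow> int" where
  "cube_zero d = (\<lambda>i\<in>{1..d}. 0)"

abbreviation cube_star :: "nat \<Rightarrow> (nat \<Rightarrow> int) set" where
  "cube_star d \<equiv> cube d - {cube_zero d}"

definition cube_dot :: "nat \<Rightarrow> (nat \<Rightarrow> int) \<Rightarrow> (nat \<Rightarrow> int) \<Rightarrow> int" where
  "cube_dot d n \<epsilon> = (\<Sum>i\<in>{1..d}. n i * \<epsilon> i)"

definition cube_space :: "nat \<Rightarrow> ((nat \<Rightarrow> int) \<Rightarrow> 'a) set" where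
  "cube_space d = cube d \<rightarrow>\<^sub>E UNIV"

definition cube_topology :: "nat \<Rightarrow> ((nat \<Rightarrow> int) \<Rightarrow> 'a::topological_space) topology" where
  "cube_topology d = product_topology (\<lambda>_. euclidean) (cube d)"

definition diagonal_point :: "nat \<Rightarrow> 'a \<Rightarrow> (nat \<Rightarrow> int) \<Rightarrow> 'a" where
  "diagonal_point d x = (\<lambda>\<epsilon>\<in>cube d. x)"

definition face_transformation ::
    "('a \<Rightarrow> 'a) \<Rightarrow> nat \<Rightarrow> nat \<Rightarrow> ((nat \<Rightarrow> int) \<Rightarrow> 'a) \<Rightarrow> ((nat \<Rightarrow> int) \<Rightarrow> 'a)" where
  "face_transformation T d j =
     (\<lambda>x\<in>cube_space d. \<lambda>\<epsilon>\<in>cube d. if \<epsilon> j = 1 then T (x \<epsilon>) else x \<epsilon>)"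

definition face_group ::
    "('a \<Rightarrow> 'a) \<Rightarrow> nat \<Rightarrow> (((nat \<Rightarrow> int) \<Rightarrow> 'a) \<Rightarrow> ((nat \<Rightarrow> int) \<Rightarrow> 'a)) set" where
  "face_group T d = generate (BijGroup (cube_space d)) (face_transformation T d ` {1..d})"

definition face_orbit_closure ::
    "('a::topological_space \<Rightarrow> 'a) \<Rightarrow> nat \<Rightarrow> 'a \<Rightarrow> ((nat \<Rightarrow> int) \<Rightarrow> 'a) set" where
  "face_orbit_closure T d x =
     cube_topology d closure_of ((\<lambda>g. g (diagonal_point d x)) ` face_group T d)"


section \<open>The regionally proximal relations and the pro-nilfactors\<close>

definition RP :: "nat \<Rightarrow> ('a::metric_space \<Rightarrow> 'a) \<Rightarrow> ('a \<times> 'a) set" where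
  "RP k T = {(x, y). \<forall>\<delta>>0. \<exists>x' y' n.
     dist x x' < \<delta> \<and> dist y y' < \<delta> \<and>
     (\<forall>\<epsilon>\<in>cube_star k.
        dist (int_iter T (cube_dot k n \<epsilon>) x') (int_iter T (cube_dot k n \<epsilon>) y') < \<delta>)}"

text \<open>\<open>Z\<^sub>0\<close> is the one-point system, and \<open>Z\<^sub>k\<close> is the quotient by \<open>RP k T\<close> for \<open>k \<ge> 1\<close>.\<close>

definition pro_nil_rel :: "nat \<Rightarrow> ('a::metric_space \<Rightarrow> 'a) \<Rightarrow> ('a \<times> 'a) set" where
  "pro_nil_rel k T = (if k = 0 then UNIV else RP k T)"

definition quotient_topology :: "('a::topological_space \<times> 'a) set \<Rightarrow> 'a set topology" where
  "quotient_topology R = topology (\<lambda>V. V \<subseteq> UNIV // R \<and> open ((\<lambda>x. R `` {x}) -` V))"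

lemma openin_quotient_topology:
  "openin (quotient_topology R) V \<longleftrightarrow> V \<subseteq> UNIV // R \<and> open ((\<lambda>x. R `` {x}) -` V)"
proof -
  have "istopology (\<lambda>V. V \<subseteq> UNIV // R \<and> open ((\<lambda>x. R `` {x}) -` V))"
    unfolding istopology_def by (auto simp: vimage_Union intro!: open_Int open_UN)
  then show ?thesis
    by (simp add: quotient_topology_def topology_inverse')
qed

definition pro_nilfactor :: "nat \<Rightarrow> ('a::metric_space \<Rightarrow> 'a) \<Rightarrow> 'a set topology" where
  "pro_nilfactor k T = quotient_topology (pro_nil_rel k T)"

definition pro_nilfactor_map :: "nat \<Rightarrow> ('a::metric_space \<Rightarrow> 'a) \<Rightarrow> 'a \<Rightarrow> 'a set" where
  "pro_nilfactor_map k T x = pro_nil_rel k T `` {x}"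

text \<open>The induced action sends the class \<open>C\<close> to its image \<open>T ` C\<close>.\<close>

definition pro_nilfactor_action :: "('a \<Rightarrow> 'a) \<Rightarrow> 'a set \<Rightarrow> 'a set" where
  "pro_nilfactor_action T = image T"


section \<open>Topological cubic characteristic factors\<close>

definition punctured_face_orbit_closure ::
    "('a::topological_space \<Rightarrow> 'a) \<Rightarrow> nat \<Rightarrow> 'a \<Rightarrow> ((nat \<Rightarrow> int) \<Rightarrow> 'a) set" where
  "punctured_face_orbit_closure T d x =
     (\<lambda>y. restrict y (cube_star d)) ` face_orbit_closure T d x"

definition saturated_on :: "'a set \<Rightarrow> ('a \<Rightarrow> 'b) \<Rightarrow> 'a set \<Rightarrow> bool" where
  "saturated_on A f F \<longleftrightarrow> F = {y \<in> A. f y \<in> f ` F}"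

definition punctured_power_map ::
    "nat \<Rightarrow> ('a \<Rightarrow> 'b) \<Rightarrow> ((nat \<Rightarrow> int) \<Rightarrow> 'a) \<Rightarrow> ((nat \<Rightarrow> int) \<Rightarrow> 'b)" where
  "punctured_power_map d \<pi> y = (\<lambda>\<epsilon>\<in>cube_star d. \<pi> (y \<epsilon>))"

definition cubic_characteristic_factor ::
    "nat \<Rightarrow> ('a::metric_space \<Rightarrow> 'a) \<Rightarrow> 'b topology \<Rightarrow> ('b \<Rightarrow> 'b) \<Rightarrow> ('a \<Rightarrow> 'b) \<Rightarrow> bool" where
  "cubic_characteristic_factor d T Y S \<pi> \<longleftrightarrow>
     factor_map euclidean T Y S \<pi> \<and>
     (\<exists>X\<^sub>0. gdelta_in euclidean X\<^sub>0 \<and> closure X\<^sub>0 = UNIV \<and>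
        (\<forall>x\<in>X\<^sub>0. saturated_on (cube_star d \<rightarrow>\<^sub>E UNIV) (punctured_power_map d \<pi>)
                    (punctured_face_orbit_closure T d x)))"

end

theory Submission
  imports Defs
begin

text \<open>
  Write \<open>Q\<close> for the set of dynamical cubes, the closure of the set of all points
  \<open>(T\<^bsup>n \<cdot> \<epsilon>\<^esup> w)\<close> of \<open>X\<^sup>[\<^sup>d\<^sup>]\<close> with \<open>w \<in> X\<close> and \<open>n \<in> \<int>\<^sup>d\<close>. Every point of the orbit closure of
  \<open>x\<^sup>[\<^sup>d\<^sup>]\<close> under the face group is a cube with base vertex \<open>x\<close>. The converse holds for generic \<open>x\<close>:
  the orbit closure depends on \<open>x\<close> in a lower semicontinuous way, hence continuously at the points of
  a dense \<open>G\<^sub>\<delta>\<close> set, and a cube with base vertex \<open>x\<close> is a limit of orbit points of base vertices near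
  \<open>x\<close> (\<open>generic_face_orbit_closure\<close>). Therefore a factor is characteristic as soon as \<open>Q\<close> is stable
  under moving its vertices, except the base vertex, inside the fibres of the factor map
  (\<open>cubic_characteristic_factorI\<close>). This is what has to be shown in both cases.

  In a weakly mixing system every point of \<open>X\<^sup>[\<^sup>d\<^sup>]\<close> is a cube. By Furstenberg's intersection lemma
  one time carries each of finitely many given open sets to a prescribed open set, and using this to
  merge opposite vertices reduces the dimension of the cube by one (\<open>cube_visits_open_sets\<close>).

  Let the system be minimal and distal. The pointwise limits of the families
  \<open>\<epsilon> \<mapsto> T\<^bsup>m + n \<cdot> \<epsilon>\<^esup>\<close> form a compact semigroup with one continuous side. Distality forces
  its idempotents to be the identity, so that by the Ellis-Numakura lemma it is a group
  (\<open>ellis_inverse\<close>). Minimality makes this group act transitively on \<open>Q\<close>, and the transitivity has a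
  geometric consequence: two cubes that share a face can be glued along it (\<open>glue_faces\<close>).
  Gluing a cube to its own reflection, one coordinate after the other, shows that whether the base
  vertex \<open>y\<close> of a cube may be replaced by \<open>x\<close> depends only on \<open>x\<close> and \<open>y\<close>, not on the other
  vertices (\<open>replace_base_iff_const\<close>). By compactness, a pair \<open>(x, y)\<close> in \<open>RP\<close> of order \<open>d - 1\<close>
  provides one cube of dimension \<open>d\<close> in which the replacement is possible, so it is possible in all of
  them. Since the cube has reflections, the same is true at every vertex. Hence \<open>Q\<close> is saturated for
  \<open>RP\<close> (\<open>dynamical_cubes_saturated\<close>), and the transitivity of \<open>RP\<close> is another instance of replacement.
\<close>

section \<open>Iterates of a homeomorphism\<close>

lemma int_iter_0 [simp]: "int_iter T 0 x = x"
  by (simp add: int_iter_def)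

lemma int_iter_1 [simp]: "int_iter T 1 x = T x"
  by (simp add: int_iter_def)

lemma int_iter_Suc:
  assumes "bij T"
  shows "int_iter T (n + 1) x = T (int_iter T n x)"
proof (cases "0 \<le> n")
  case True
  then show ?thesis by (simp add: int_iter_def nat_add_distrib)
next
  case False
  then obtain k where k: "nat (- n) = Suc k" by (cases "nat (- n)") auto
  with False have n: "n = - int k - 1" by auto
  have "T (inv_into UNIV T y) = y" for y
    using assms by (simp add: bij_is_surj surj_f_inv_f)
  moreover have "nat (- (n + 1)) = k" using n by simp
  ultimately show ?thesis
    using n k False by (cases "k = 0") (auto simp: int_iter_def)
qed

lemma int_iter_add:
  assumes "bij T"
  shows "int_iter T (m + n) x = int_iter T m (int_iter T n x)"
proof (induction m rule: int_induct [where k = 0])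
  case base
  show ?case by simp
next
  case (step1 i)
  have "int_iter T (i + 1 + n) x = int_iter T ((i + n) + 1) x" by (simp add: ac_simps)
  then show ?case by (simp only: int_iter_Suc [OF assms] step1)
next
  case (step2 i)
  have "T (int_iter T (i - 1 + n) x) = int_iter T ((i - 1 + n) + 1) x"
    by (simp only: int_iter_Suc [OF assms])
  also have "\<dots> = int_iter T (i + n) x" by (simp add: algebra_simps)
  also have "\<dots> = int_iter T ((i - 1) + 1) (int_iter T n x)" using step2 by simp
  also have "\<dots> = T (int_iter T (i - 1) (int_iter T n x))" by (simp only: int_iter_Suc [OF assms])
  finally show ?case using assms by (meson bij_is_inj injD)
qed

lemma int_iter_minus [simp]:
  assumes "bij T"
  shows "int_iter T (- n) (int_iter T n x) = x" and "int_iter T n (int_iter T (- n) x) = x"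
  using int_iter_add [OF assms, of "- n" n x] int_iter_add [OF assms, of n "- n" x] by simp_all

locale compact_system =
  fixes T :: "'a::metric_space \<Rightarrow> 'a"
  assumes system: "dynamical_system (euclidean :: 'a topology) T"
begin

lemma compact_UNIV: "compact (UNIV :: 'a set)"
  using system by (simp add: dynamical_system_def compact_space_def)

lemma bij_T: "bij T"
  using system by (simp add: dynamical_system_def homeomorphic_eq_everything_map bij_def)

lemma continuous_T: "continuous_on UNIV T"
  using system homeomorphic_imp_continuous_map [of euclidean euclidean T]
  by (simp add: dynamical_system_def)

lemma continuous_inv_T: "continuous_on UNIV (inv_into UNIV T)"
proof -
  have "open (inv_into UNIV T -` U)" if "open U" for U
  proof -
    have "open (T ` U)"
      using system that homeomorphic_imp_open_map unfolding dynamical_system_def open_map_def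
      by fastforce
    then show ?thesis
      by (simp add: bij_T bij_vimage_eq_inv_image bij_imp_bij_inv inv_inv_eq)
  qed
  then show ?thesis by (simp add: continuous_on_open_vimage)
qed

lemma continuous_int_iter: "continuous_on UNIV (int_iter T n)"
proof -
  have *: "continuous_on UNIV (f ^^ k)" if "continuous_on UNIV f" for f :: "'a \<Rightarrow> 'a" and k
  proof (induction k)
    case (Suc k)
    have "continuous_on ((f ^^ k) ` UNIV) f" using that continuous_on_subset by blast
    then show ?case using continuous_on_compose [OF Suc] by simp
  qed (simp add: continuous_on_id)
  show ?thesis
    unfolding int_iter_def using *[OF continuous_T] *[OF continuous_inv_T] by auto
qed

text \<open>
  Finitely many iterates have a common modulus of continuity, as they are continuous on a compact
  space.
\<close>

lemma uniformly_int_iter: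
  assumes "finite N" "0 < e"
  obtains r where "0 < r" "\<And>x y n. n \<in> N \<Longrightarrow> dist x y < r \<Longrightarrow> dist (int_iter T n x) (int_iter T n y) < e"
  using assms
proof (induction arbitrary: thesis rule: finite_induct)
  case empty
  show ?case using empty(1) [of 1] by simp
next
  case (insert n N)
  obtain r where r: "0 < r" "\<And>x y n. n \<in> N \<Longrightarrow> dist x y < r \<Longrightarrow> dist (int_iter T n x) (int_iter T n y) < e"
    using insert.IH insert.prems by blast
  have "uniformly_continuous_on UNIV (int_iter T n)"
    using compact_UNIV compact_uniformly_continuous continuous_int_iter by blast
  then obtain s where "0 < s" "\<And>x y. dist x y < s \<Longrightarrow> dist (int_iter T n x) (int_iter T n y) < e"
    using \<open>0 < e\<close> unfolding uniformly_continuous_on_def by (metis UNIV_I dist_commute)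
  with r show ?case
    by (intro insert.prems(1) [of "min r s"]) auto
qed

lemma open_int_iter_vimage: "open U \<Longrightarrow> open (int_iter T n -` U)"
  using continuous_int_iter continuous_on_open_vimage by (metis Int_UNIV_right open_UNIV)

end

section \<open>Orbits of the face group\<close>

lemma cube_zero_in_cube [simp]: "cube_zero d \<in> cube d"
  by (simp add: cube_zero_def cube_def)

lemma finite_cube [simp]: "finite (cube d)"
  unfolding cube_def by (intro finite_PiE) auto

lemma cube_dot_zero_left [simp]: "cube_dot d (\<lambda>_. 0) \<epsilon> = 0"
  by (simp add: cube_dot_def)

lemma cube_dot_cube_zero [simp]: "cube_dot d n (cube_zero d) = 0"
  by (simp add: cube_dot_def cube_zero_def)

lemma cube_dot_add: "cube_dot d (\<lambda>i. m i + n i) \<epsilon> = cube_dot d m \<epsilon> + cube_dot d n \<epsilon>"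
  by (simp add: cube_dot_def sum.distrib algebra_simps)

lemma cube_dot_single:
  "cube_dot d (\<lambda>i. if i = j then c else 0) \<epsilon> = (if j \<in> {1..d} then c * \<epsilon> j else 0)"
proof -
  have "cube_dot d (\<lambda>i. if i = j then c else 0) \<epsilon> = (\<Sum>i\<in>{1..d}. if i = j then c * \<epsilon> j else 0)"
    unfolding cube_dot_def by (intro sum.cong) auto
  then show ?thesis by (simp only: sum.delta finite_atLeastAtMost)
qed

lemma cubeD: "\<epsilon> \<in> cube d \<Longrightarrow> i \<in> {1..d} \<Longrightarrow> \<epsilon> i = 0 \<or> \<epsilon> i = 1"
  by (auto simp: cube_def PiE_iff)

text \<open>
  The general element of the face group, \<open>\<Prod>\<^sub>j (T\<^sub>j\<^sup>[\<^sup>d\<^sup>])\<^bsup>n j\<^esup>\<close>. Like every element of \<open>BijGroup\<close>, it is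
  extensional.
\<close>

definition cube_translation :: "('a \<Rightarrow> 'a) \<Rightarrow> nat \<Rightarrow> (nat \<Rightarrow> int) \<Rightarrow> ((nat \<Rightarrow> int) \<Rightarrow> 'a) \<Rightarrow> ((nat \<Rightarrow> int) \<Rightarrow> 'a)" where
  "cube_translation T d n = (\<lambda>x\<in>cube_space d. \<lambda>\<epsilon>\<in>cube d. int_iter T (cube_dot d n \<epsilon>) (x \<epsilon>))"

lemma cube_translation_in_cube_space:
  "x \<in> cube_space d \<Longrightarrow> cube_translation T d n x \<in> cube_space d"
  by (simp add: cube_translation_def cube_space_def)

lemma cube_translation_add:
  assumes "bij T" "x \<in> cube_space d"
  shows "cube_translation T d m (cube_translation T d n x) = cube_translation T d (\<lambda>i. m i + n i) x"
  using assms cube_translation_in_cube_space [OF assms(2), of T n]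
  by (auto simp: cube_translation_def cube_dot_add int_iter_add fun_eq_iff)

lemma cube_translation_0: "cube_translation T d (\<lambda>_. 0) = (\<lambda>x\<in>cube_space d. x)"
  by (auto simp: cube_translation_def fun_eq_iff cube_space_def PiE_iff extensional_def)

lemma cube_translation_Bij:
  assumes "bij T"
  shows "cube_translation T d n \<in> Bij (cube_space d)"
proof -
  have inv: "cube_translation T d m (cube_translation T d (\<lambda>i. - m i) x) = x"
    if "x \<in> cube_space d" for x :: "(nat \<Rightarrow> int) \<Rightarrow> 'a" and m
    using that by (simp add: cube_translation_add [OF assms] cube_translation_0)
  have "bij_betw (cube_translation T d n) (cube_space d) (cube_space d)"
    using inv [of _ n] inv [of _ "\<lambda>i. - n i"] cube_translation_in_cube_space
    by (intro bij_betwI [where g = "cube_translation T d (\<lambda>i. - n i)"]) auto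
  then show ?thesis by (simp add: Bij_def cube_translation_def)
qed

lemma mult_cube_translation:
  assumes "bij T"
  shows "cube_translation T d m \<otimes>\<^bsub>BijGroup (cube_space d)\<^esub> cube_translation T d n =
         cube_translation T d (\<lambda>i. m i + n i)"
proof -
  have "compose (cube_space d) (cube_translation T d m) (cube_translation T d n) x =
        cube_translation T d (\<lambda>i. m i + n i) x" for x
  proof (cases "x \<in> cube_space d")
    case True
    then show ?thesis by (simp add: compose_eq cube_translation_add [OF assms])
  qed (simp add: compose_def cube_translation_def)
  then show ?thesis
    by (auto simp: BijGroup_def cube_translation_Bij [OF assms])
qed

lemma inv_cube_translation:
  assumes "bij T"
  shows "inv\<^bsub>BijGroup (cube_space d)\<^esub> cube_translation T d n = cube_translation T d (\<lambda>i. - n i)"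
proof (rule group.inv_equality [OF group_BijGroup])
  show "cube_translation T d (\<lambda>i. - n i) \<otimes>\<^bsub>BijGroup (cube_space d)\<^esub> cube_translation T d n =
        \<one>\<^bsub>BijGroup (cube_space d)\<^esub>"
    by (simp add: mult_cube_translation [OF assms] cube_translation_0) (simp add: BijGroup_def)
qed (simp_all add: BijGroup_def cube_translation_Bij [OF assms])

lemma face_transformation_eq_cube_translation:
  assumes "j \<in> {1..d}"
  shows "face_transformation T d j = cube_translation T d (\<lambda>i. if i = j then 1 else 0)"
proof -
  have "(if \<epsilon> j = 1 then T y else y) = int_iter T (cube_dot d (\<lambda>i. if i = j then 1 else 0) \<epsilon>) y"
    if "\<epsilon> \<in> cube d" for \<epsilon> y
    using assms cubeD [OF that assms] by (auto simp: cube_dot_single)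
  then show ?thesis
    unfolding face_transformation_def cube_translation_def by (auto simp: fun_eq_iff)
qed

text \<open>
  The face transformations commute, so the words in them and their inverses are the translations by
  \<open>n \<in> \<int>\<^sup>d\<close>. Conversely, such a translation is a product over the coordinates of powers of the generators.
\<close>

lemma face_group_eq:
  assumes "bij T"
  shows "face_group T d = range (cube_translation T d)"
proof
  show "face_group T d \<subseteq> range (cube_translation T d)"
  proof
    fix g assume "g \<in> face_group T d"
    then show "g \<in> range (cube_translation T d)"
      unfolding face_group_def
    proof (induction rule: generate.induct)
      case one
      have "\<one>\<^bsub>BijGroup (cube_space d)\<^esub> = cube_translation T d (\<lambda>_. 0)"
        by (simp add: cube_translation_0 BijGroup_def)
      then show ?case by blast
    next
      case (incl h)
      then show ?case by (auto simp: face_transformation_eq_cube_translation)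
    next
      case (inv h)
      then show ?case
        by (auto simp: face_transformation_eq_cube_translation inv_cube_translation [OF assms])
    next
      case (eng h1 h2)
      then show ?case by (auto simp: mult_cube_translation [OF assms])
    qed
  qed
next
  let ?G = "BijGroup (cube_space d) :: (((nat \<Rightarrow> int) \<Rightarrow> 'a) \<Rightarrow> _) monoid"
  have mult: "cube_translation T d (\<lambda>i. m i + n i) \<in> face_group T d"
    if "cube_translation T d m \<in> face_group T d" "cube_translation T d n \<in> face_group T d" for m n
    using generate.eng [OF that [unfolded face_group_def]]
    by (simp only: face_group_def mult_cube_translation [OF assms])
  have single: "cube_translation T d (\<lambda>i. if i = j then c else 0) \<in> face_group T d"
    if "j \<in> {1..d}" for j c
  proof (induction c rule: int_induct [where k = 0])
    case base
    have "cube_translation T d (\<lambda>_. 0) = \<one>\<^bsub>?G\<^esub>"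
      by (simp add: cube_translation_0 BijGroup_def)
    then show ?case unfolding face_group_def using generate.one [of ?G] by simp
  next
    case (step1 c)
    have "face_transformation T d j \<in> face_group T d"
      unfolding face_group_def using that by (intro generate.incl) auto
    then have one: "cube_translation T d (\<lambda>i. if i = j then 1 else 0) \<in> face_group T d"
      by (simp only: face_transformation_eq_cube_translation [OF that])
    have eq: "(\<lambda>i. (if i = j then c else 0) + (if i = j then 1 else 0)) = (\<lambda>i. if i = j then c + 1 else 0)"
      by auto
    show ?case using mult [OF step1(2) one] unfolding eq .
  next
    case (step2 c)
    have "inv\<^bsub>?G\<^esub> (face_transformation T d j) \<in> face_group T d"
      unfolding face_group_def using that by (intro generate.inv) auto
    then have minus: "cube_translation T d (\<lambda>i. - (if i = j then 1 else 0)) \<in> face_group T d"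
      by (simp only: face_transformation_eq_cube_translation [OF that] inv_cube_translation [OF assms])
    have eq: "(\<lambda>i. (if i = j then c else 0) + - (if i = j then 1 else 0)) = (\<lambda>i. if i = j then c - 1 else 0)"
      by auto
    show ?case using mult [OF step2(2) minus] unfolding eq .
  qed
  show "range (cube_translation T d) \<subseteq> face_group T d"
  proof clarify
    fix n
    have "cube_translation T d (\<lambda>i. if i \<in> {1..k} then n i else 0) \<in> face_group T d" if "k \<le> d" for k
      using that
    proof (induction k)
      case 0
      have "cube_translation T d (\<lambda>_. 0) = \<one>\<^bsub>?G\<^esub>"
        by (simp add: cube_translation_0 BijGroup_def)
      then show ?case unfolding face_group_def using generate.one [of ?G] by simp
    next
      case (Suc k)
      have "(\<lambda>i. if i \<in> {1..Suc k} then n i else 0) =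
            (\<lambda>i. (if i \<in> {1..k} then n i else 0) + (if i = Suc k then n (Suc k) else 0))"
        by (auto simp: fun_eq_iff)
      then show ?case using mult [OF Suc.IH single [of "Suc k" "n (Suc k)"]] Suc.prems by simp
    qed
    moreover have "cube_translation T d (\<lambda>i. if i \<in> {1..d} then n i else 0) = cube_translation T d n"
      by (simp add: cube_translation_def cube_dot_def)
    ultimately show "cube_translation T d n \<in> face_group T d" by (metis order_refl)
  qed
qed

text \<open>
  A product of finitely many metric spaces carries the topology of uniform approximation.
\<close>

lemma closure_of_finite_product:
  fixes S :: "('i \<Rightarrow> 'a::metric_space) set"
  assumes "finite I" "y \<in> I \<rightarrow>\<^sub>E UNIV" "S \<subseteq> I \<rightarrow>\<^sub>E UNIV"
  shows "y \<in> product_topology (\<lambda>_. euclidean) I closure_of S \<longleftrightarrow>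
         (\<forall>\<delta>>0. \<exists>s\<in>S. \<forall>i\<in>I. dist (s i) (y i) < \<delta>)" (is "?L \<longleftrightarrow> ?R")
proof
  assume ?L
  show ?R
  proof (intro allI impI)
    fix \<delta> :: real assume "0 < \<delta>"
    have "openin (product_topology (\<lambda>_. euclidean) I) (PiE I (\<lambda>i. ball (y i) \<delta>))"
      using \<open>finite I\<close> by (auto simp: openin_PiE_gen)
    moreover have "y \<in> PiE I (\<lambda>i. ball (y i) \<delta>)"
      using assms \<open>0 < \<delta>\<close> by (auto simp: PiE_iff)
    ultimately obtain s where "s \<in> S" "s \<in> PiE I (\<lambda>i. ball (y i) \<delta>)"
      using \<open>?L\<close> by (auto simp: in_closure_of)
    then show "\<exists>s\<in>S. \<forall>i\<in>I. dist (s i) (y i) < \<delta>"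
      by (auto simp: PiE_iff dist_commute)
  qed
next
  assume R: ?R
  show ?L
    unfolding in_closure_of
  proof (intro conjI allI impI)
    show "y \<in> topspace (product_topology (\<lambda>_. euclidean) I)" using assms by simp
    fix W assume "y \<in> W \<and> openin (product_topology (\<lambda>_. euclidean) I) W"
    then obtain U where U: "\<And>i. i \<in> I \<Longrightarrow> open (U i)" "y \<in> PiE I U" "PiE I U \<subseteq> W"
      unfolding openin_product_topology_alt by (metis open_openin)
    have "\<exists>\<delta>>0. \<forall>i\<in>I. ball (y i) \<delta> \<subseteq> U i"
    proof -
      have "\<forall>i\<in>I. \<exists>e>0. ball (y i) e \<subseteq> U i"
        using U by (meson PiE_mem open_contains_ball)
      then obtain e where e: "\<And>i. i \<in> I \<Longrightarrow> 0 < e i \<and> ball (y i) (e i) \<subseteq> U i" by metis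
      have "0 < Min (insert 1 (e ` I))" using \<open>finite I\<close> e by (subst Min_gr_iff) auto
      moreover have "ball (y i) (Min (insert 1 (e ` I))) \<subseteq> U i" if "i \<in> I" for i
      proof -
        have "Min (insert 1 (e ` I)) \<le> e i" using \<open>finite I\<close> that by (intro Min_le) auto
        then show ?thesis using e [OF that] by (meson subset_ball subset_trans)
      qed
      ultimately show ?thesis by blast
    qed
    then obtain \<delta> where "0 < \<delta>" and \<delta>: "\<And>i. i \<in> I \<Longrightarrow> ball (y i) \<delta> \<subseteq> U i" by blast
    then obtain s where "s \<in> S" "\<forall>i\<in>I. dist (s i) (y i) < \<delta>" using R by blast
    moreover have "s \<in> extensional I" using \<open>s \<in> S\<close> assms(3) by (auto simp: PiE_iff)
    ultimately have "s \<in> PiE I U"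
      using \<delta> by (intro PiE_I) (auto simp: subset_iff dist_commute extensional_def)
    then show "\<exists>s. s \<in> S \<and> s \<in> W" using U \<open>s \<in> S\<close> by blast
  qed
qed

lemma (in compact_system) in_face_orbit_closure_iff:
  assumes "y \<in> cube_space d"
  shows "y \<in> face_orbit_closure T d x \<longleftrightarrow>
         (\<forall>\<delta>>0. \<exists>n. \<forall>\<epsilon>\<in>cube d. dist (int_iter T (cube_dot d n \<epsilon>) x) (y \<epsilon>) < \<delta>)"
proof -
  have diag: "diagonal_point d x \<in> cube_space d"
    by (simp add: diagonal_point_def cube_space_def)
  have "(\<lambda>g. g (diagonal_point d x)) ` face_group T d =
        range (\<lambda>n. \<lambda>\<epsilon>\<in>cube d. int_iter T (cube_dot d n \<epsilon>) x)"
    unfolding face_group_eq [OF bij_T] image_image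
    by (intro image_cong) (use diag in \<open>auto simp: cube_translation_def diagonal_point_def\<close>)
  then show ?thesis
    unfolding face_orbit_closure_def cube_topology_def
    using assms by (subst closure_of_finite_product) (auto simp: cube_space_def)
qed


section \<open>Dynamical cubes and generic points\<close>

text \<open>
  The set \<open>Q\<close>, given by approximation. It contains total functions, and only their values on \<open>cube d\<close>
  matter; this allows a cube to be composed with any map of the index set. The factor \<open>T\<^sup>m\<close> of the
  full cube group is absorbed by the free point \<open>w\<close>.
\<close>

definition dynamical_cubes :: "('a::metric_space \<Rightarrow> 'a) \<Rightarrow> nat \<Rightarrow> ((nat \<Rightarrow> int) \<Rightarrow> 'a) set" where
  "dynamical_cubes T d =
     {y. \<forall>\<delta>>0. \<exists>w n. \<forall>\<epsilon>\<in>cube d. dist (int_iter T (cube_dot d n \<epsilon>) w) (y \<epsilon>) < \<delta>}"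

lemma dynamical_cubesI:
  assumes "\<And>\<delta>. 0 < \<delta> \<Longrightarrow> \<exists>w n. \<forall>\<epsilon>\<in>cube d. dist (int_iter T (cube_dot d n \<epsilon>) w) (y \<epsilon>) < \<delta>"
  shows "y \<in> dynamical_cubes T d"
  using assms by (simp add: dynamical_cubes_def)

lemma dynamical_cubesE:
  assumes "y \<in> dynamical_cubes T d" "0 < \<delta>"
  obtains w n where "\<And>\<epsilon>. \<epsilon> \<in> cube d \<Longrightarrow> dist (int_iter T (cube_dot d n \<epsilon>) w) (y \<epsilon>) < \<delta>"
  using assms unfolding dynamical_cubes_def by blast

lemma dynamical_cubes_cong:
  assumes "y \<in> dynamical_cubes T d" "\<And>\<epsilon>. \<epsilon> \<in> cube d \<Longrightarrow> y \<epsilon> = z \<epsilon>"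
  shows "z \<in> dynamical_cubes T d"
  using assms by (simp add: dynamical_cubes_def)

context compact_system
begin

lemma face_orbit_closure_subset:
  assumes "y \<in> face_orbit_closure T d x"
  shows "y \<in> cube_space d" "y \<in> dynamical_cubes T d" "y (cube_zero d) = x"
proof -
  show cs: "y \<in> cube_space d"
    using assms unfolding face_orbit_closure_def cube_topology_def cube_space_def
    by (simp add: in_closure_of)
  have *: "\<exists>n. \<forall>\<epsilon>\<in>cube d. dist (int_iter T (cube_dot d n \<epsilon>) x) (y \<epsilon>) < \<delta>" if "0 < \<delta>" for \<delta>
    using that assms in_face_orbit_closure_iff [OF cs] by blast
  then show "y \<in> dynamical_cubes T d" by (intro dynamical_cubesI) blast
  have "dist x (y (cube_zero d)) < \<delta>" if "0 < \<delta>" for \<delta>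
    using *[OF that] cube_zero_in_cube [of d] by (force dest!: bspec [where x = "cube_zero d"])
  then show "y (cube_zero d) = x"
    by (metis dist_commute dist_self less_irrefl zero_less_dist_iff)
qed

lemma finite_net:
  assumes "0 < e"
  obtains N :: "'a set" where "finite N" "\<And>x. \<exists>c\<in>N. dist c x < e"
proof -
  obtain N :: "'a set" where N: "finite N" "UNIV \<subseteq> (\<Union>x\<in>N. ball x e)"
    using seq_compact_imp_totally_bounded [OF compact_imp_seq_compact [OF compact_UNIV]] assms by blast
  show ?thesis
  proof
    fix x
    have "x \<in> (\<Union>x\<in>N. ball x e)" using N(2) by blast
    then show "\<exists>c\<in>N. dist c x < e" by auto
  qed (rule N(1))
qed

lemma finite_nets:
  obtains N :: "nat \<Rightarrow> 'a set"
    where "\<And>k. finite (N k)" "\<And>k x. \<exists>c\<in>N k. dist c x < inverse (real (Suc k))"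
proof -
  have "\<exists>N :: 'a set. finite N \<and> (\<forall>x. \<exists>c\<in>N. dist c x < inverse (real (Suc k)))" for k
  proof (rule finite_net)
    show "0 < inverse (real (Suc k))" by simp
  qed blast
  then show ?thesis using that by metis
qed

text \<open>
  For each prescription \<open>c\<close> of vertices and each precision, the set of the \<open>x\<close> whose face orbit meets
  the prescription is open, so its boundary is closed and nowhere dense. By Baire's theorem the points that lie on
  none of countably many such boundaries form a dense \<open>G\<^sub>\<delta>\<close> set. For such an \<open>x\<close>, to be a limit of points
  that meet a prescription is as good as to meet it.
\<close>

lemma generic_face_orbit_closure:
  obtains X\<^sub>0 where "gdelta_in euclidean X\<^sub>0" "closure X\<^sub>0 = UNIV"
    "\<And>y. y (cube_zero d) \<in> X\<^sub>0 \<Longrightarrow> y \<in> cube_space d \<Longrightarrow> y \<in> dynamical_cubes T d \<Longrightarrow>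
      y \<in> face_orbit_closure T d (y (cube_zero d))"
proof -
  obtain N :: "nat \<Rightarrow> 'a set"
    where fin: "\<And>k. finite (N k)" and net: "\<And>k x. \<exists>c\<in>N k. dist c x < inverse (real (Suc k))"
    by (rule finite_nets) (rule that)
  define V where "V k c = {x. \<exists>n. \<forall>\<epsilon>\<in>cube d. dist (int_iter T (cube_dot d n \<epsilon>) x) (c \<epsilon>) < inverse (real (Suc k))}"
    for k :: nat and c
  have open_V: "open (V k c)" for k c
  proof -
    have "V k c = (\<Union>n. \<Inter>\<epsilon>\<in>cube d. int_iter T (cube_dot d n \<epsilon>) -` ball (c \<epsilon>) (inverse (real (Suc k))))"
      by (rule Set.set_eqI) (simp add: V_def dist_commute)
    then show ?thesis
      by (auto intro!: open_UN open_INT open_int_iter_vimage)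
  qed
  define \<G> where "\<G> = (\<Union>k. (\<lambda>c. V k c \<union> - closure (V k c)) ` (cube d \<rightarrow>\<^sub>E N k))"
  have "countable (cube d \<rightarrow>\<^sub>E N k)" for k
    by (intro countable_finite finite_PiE fin finite_cube)
  then have "countable \<G>"
    unfolding \<G>_def by (intro countable_UN countable_image) auto
  have \<G>: "open G \<and> closure G = UNIV" if "G \<in> \<G>" for G
  proof -
    obtain k c where G: "G = V k c \<union> - closure (V k c)" using \<open>G \<in> \<G>\<close> by (auto simp: \<G>_def)
    have "- closure (V k c) \<subseteq> closure G" using G closure_subset [of G] by blast
    moreover have "closure (V k c) \<subseteq> closure G" using G by (intro closure_mono) blast
    moreover have "open G" unfolding G by (intro open_Un open_V open_Compl closed_closure)
    ultimately show ?thesis by blast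
  qed
  have "cube d \<rightarrow>\<^sub>E N 0 \<noteq> {}" using net by (auto simp: PiE_eq_empty_iff)
  then have "\<G> \<noteq> {}" by (auto simp: \<G>_def)
  show ?thesis
  proof
    show "gdelta_in euclidean (\<Inter>\<G>)"
      using \<open>countable \<G>\<close> \<open>\<G> \<noteq> {}\<close> \<G> by (intro gdelta_in_Inter) (auto intro: open_imp_gdelta_in)
    have reg: "regular_space (euclidean :: 'a topology)"
      by (simp add: metrizable_imp_regular_space metrizable_space_euclidean)
    moreover have "compact_space (euclidean :: 'a topology)"
      using system by (simp add: dynamical_system_def)
    ultimately have "locally_compact_space (euclidean :: 'a topology)"
      by (simp add: compact_imp_locally_compact_space)
    then have "euclidean closure_of \<Inter>\<G> = topspace (euclidean :: 'a topology)"
      using reg \<open>countable \<G>\<close> \<G> by (intro Baire_category) auto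
    then show "closure (\<Inter>\<G>) = UNIV" by simp
  next
    fix y assume x: "y (cube_zero d) \<in> \<Inter>\<G>" and y: "y \<in> cube_space d" "y \<in> dynamical_cubes T d"
    let ?x = "y (cube_zero d)"
    have "\<exists>n. \<forall>\<epsilon>\<in>cube d. dist (int_iter T (cube_dot d n \<epsilon>) ?x) (y \<epsilon>) < \<delta>" if "0 < \<delta>" for \<delta>
    proof -
      obtain k where k: "inverse (real (Suc k)) < \<delta> / 2"
        using \<open>0 < \<delta>\<close> reals_Archimedean half_gt_zero by blast
      \<comment> \<open>Prescribe vertices from the net that are close to those of \<open>y\<close>.\<close>
      have "\<exists>a. a \<in> N k \<and> dist a (y \<epsilon>) < inverse (real (Suc k))" for \<epsilon>
        using net by blast
      then obtain c where c: "\<And>\<epsilon>. c \<epsilon> \<in> N k \<and> dist (c \<epsilon>) (y \<epsilon>) < inverse (real (Suc k))"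
        by metis
      define c' where "c' = restrict c (cube d)"
      have c': "c' \<in> cube d \<rightarrow>\<^sub>E N k" using c by (auto simp: c'_def)
      \<comment> \<open>The base points of cubes close to \<open>y\<close> lie in \<open>V k c'\<close> and converge to \<open>?x\<close>.\<close>
      have "?x \<in> closure (V k c')"
        unfolding closure_approachable
      proof (intro allI impI)
        fix e :: real assume "0 < e"
        \<comment> \<open>The margin by which \<open>y\<close> itself meets the prescription \<open>c'\<close>.\<close>
        define s where "s = Min ((\<lambda>\<epsilon>. inverse (real (Suc k)) - dist (c \<epsilon>) (y \<epsilon>)) ` cube d)"
        have "cube d \<noteq> {}" using cube_zero_in_cube by blast
        then have "0 < s" unfolding s_def using c by (subst Min_gr_iff) auto
        have s: "s \<le> inverse (real (Suc k)) - dist (c \<epsilon>) (y \<epsilon>)" if "\<epsilon> \<in> cube d" for \<epsilon>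
          unfolding s_def using that by (intro Min_le) auto
        obtain w n where w: "\<And>\<epsilon>. \<epsilon> \<in> cube d \<Longrightarrow> dist (int_iter T (cube_dot d n \<epsilon>) w) (y \<epsilon>) < min e s"
          using dynamical_cubesE [OF y(2), of "min e s"] \<open>0 < e\<close> \<open>0 < s\<close> by (metis min_less_iff_conj)
        have "dist (int_iter T (cube_dot d n \<epsilon>) w) (c' \<epsilon>) < inverse (real (Suc k))"
          if "\<epsilon> \<in> cube d" for \<epsilon>
          using w [OF that] s [OF that] that
            dist_triangle2 [of "int_iter T (cube_dot d n \<epsilon>) w" "c \<epsilon>" "y \<epsilon>"]
          by (simp add: c'_def)
        then have "w \<in> V k c'" by (auto simp: V_def)
        moreover have "dist w ?x < e" using w [of "cube_zero d"] by simp
        ultimately show "\<exists>w\<in>V k c'. dist w ?x < e" by blast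
      qed
      moreover have "?x \<in> V k c' \<union> - closure (V k c')"
        using x c' by (auto simp: \<G>_def)
      ultimately have "?x \<in> V k c'" by blast
      then obtain n where n: "\<And>\<epsilon>. \<epsilon> \<in> cube d \<Longrightarrow> dist (int_iter T (cube_dot d n \<epsilon>) ?x) (c' \<epsilon>) < inverse (real (Suc k))"
        by (auto simp: V_def)
      have "dist (int_iter T (cube_dot d n \<epsilon>) ?x) (y \<epsilon>) < \<delta>" if "\<epsilon> \<in> cube d" for \<epsilon>
        using n [OF that] c [of \<epsilon>] k that dist_triangle [of "int_iter T (cube_dot d n \<epsilon>) ?x" "y \<epsilon>" "c \<epsilon>"]
        by (simp add: c'_def)
      then show ?thesis by blast
    qed
    then show "y \<in> face_orbit_closure T d ?x" using in_face_orbit_closure_iff [OF y(1)] by blast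
  qed
qed

text \<open>
  At a generic point the orbit closure consists of all cubes with that base vertex, so saturation of the
  set of cubes is inherited by the punctured orbit closures.
\<close>

proposition cubic_characteristic_factorI:
  assumes factor: "factor_map euclidean T Y S \<pi>"
    and saturated: "\<And>y z. y \<in> dynamical_cubes T d \<Longrightarrow> z (cube_zero d) = y (cube_zero d) \<Longrightarrow>
      (\<And>\<epsilon>. \<epsilon> \<in> cube_star d \<Longrightarrow> \<pi> (z \<epsilon>) = \<pi> (y \<epsilon>)) \<Longrightarrow> z \<in> dynamical_cubes T d"
  shows "cubic_characteristic_factor d T Y S \<pi>"
proof -
  obtain X\<^sub>0 where X0: "gdelta_in euclidean X\<^sub>0" "closure X\<^sub>0 = UNIV"
    "\<And>y. y (cube_zero d) \<in> X\<^sub>0 \<Longrightarrow> y \<in> cube_space d \<Longrightarrow> y \<in> dynamical_cubes T d \<Longrightarrow>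
      y \<in> face_orbit_closure T d (y (cube_zero d))"
    using generic_face_orbit_closure [of d] by blast
  have "saturated_on (cube_star d \<rightarrow>\<^sub>E UNIV) (punctured_power_map d \<pi>) (punctured_face_orbit_closure T d x)"
    if "x \<in> X\<^sub>0" for x
    unfolding saturated_on_def
  proof (intro equalityI subsetI)
    fix y assume "y \<in> punctured_face_orbit_closure T d x"
    then show "y \<in> {y \<in> cube_star d \<rightarrow>\<^sub>E UNIV. punctured_power_map d \<pi> y \<in>
        punctured_power_map d \<pi> ` punctured_face_orbit_closure T d x}"
      by (auto simp: punctured_face_orbit_closure_def split: if_splits)
  next
    fix y assume "y \<in> {y \<in> cube_star d \<rightarrow>\<^sub>E UNIV. punctured_power_map d \<pi> y \<in>
        punctured_power_map d \<pi> ` punctured_face_orbit_closure T d x}"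
    then obtain z where y: "y \<in> cube_star d \<rightarrow>\<^sub>E UNIV" and z: "z \<in> face_orbit_closure T d x"
      and eq: "punctured_power_map d \<pi> y = punctured_power_map d \<pi> (restrict z (cube_star d))"
      unfolding punctured_face_orbit_closure_def image_image by blast
    define y' where "y' = (\<lambda>\<epsilon>. if \<epsilon> = cube_zero d then x else y \<epsilon>)"
    have "\<pi> (y' \<epsilon>) = \<pi> (z \<epsilon>)" if "\<epsilon> \<in> cube_star d" for \<epsilon>
      using fun_cong [OF eq, of \<epsilon>] that by (auto simp: punctured_power_map_def y'_def)
    moreover have "y' (cube_zero d) = z (cube_zero d)"
      using face_orbit_closure_subset(3) [OF z] by (simp add: y'_def)
    ultimately have "y' \<in> dynamical_cubes T d"
      using saturated [OF face_orbit_closure_subset(2) [OF z]] by blast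
    moreover have "y' \<in> cube_space d"
      using y by (auto simp: cube_space_def y'_def PiE_iff extensional_def)
    ultimately have "y' \<in> face_orbit_closure T d x"
      using X0(3) [of y'] \<open>x \<in> X\<^sub>0\<close> by (simp add: y'_def)
    moreover have "y = restrict y' (cube_star d)"
      using y by (auto simp: fun_eq_iff y'_def PiE_iff extensional_def)
    ultimately show "y \<in> punctured_face_orbit_closure T d x"
      by (auto simp: punctured_face_orbit_closure_def)
  qed
  then show ?thesis
    unfolding cubic_characteristic_factor_def using factor X0(1,2) by blast
qed

end

section \<open>Weakly mixing systems\<close>

lemma int_iter_map_prod:
  assumes "bij T"
  shows "int_iter (map_prod T T) n (x, y) = (int_iter T n x, int_iter T n y)"
proof -
  have bij: "bij (map_prod T T)"
    using assms by (simp add: bij_def prod.inj_map map_prod_surj)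
  show ?thesis
  proof (induction n rule: int_induct [where k = 0])
    case (step2 n)
    have "map_prod T T (int_iter (map_prod T T) (n - 1) (x, y)) =
          map_prod T T (int_iter T (n - 1) x, int_iter T (n - 1) y)"
      using int_iter_Suc [OF bij, of "n - 1" "(x, y)"] int_iter_Suc [OF assms, of "n - 1"] step2
      by simp
    then show ?case using bij by (meson bij_is_inj injD)
  qed (simp_all add: int_iter_Suc [OF bij] int_iter_Suc [OF assms])
qed

locale weakly_mixing_system = compact_system +
  assumes weakly_mixing: "weakly_mixing T"
begin

lemma common_hitting_time:
  assumes "open U" "open V" "open U'" "open V'" "U \<noteq> {}" "V \<noteq> {}" "U' \<noteq> {}" "V' \<noteq> {}"
  obtains n x x' where "x \<in> U" "int_iter T n x \<in> V" "x' \<in> U'" "int_iter T n x' \<in> V'"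
proof -
  have "open (U \<times> U')" "open (V \<times> V')" "U \<times> U' \<noteq> {}" "V \<times> V' \<noteq> {}"
    using assms by (auto intro: open_Times)
  then obtain n where "U \<times> U' \<inter> int_iter (map_prod T T) n -` (V \<times> V') \<noteq> {}"
    using weakly_mixing unfolding weakly_mixing_def transitive_system_def by meson
  then show ?thesis
    using that by (auto simp: int_iter_map_prod [OF bij_T])
qed

text \<open>
  Furstenberg's intersection lemma: the sets of times \<open>{n. A \<inter> T\<^bsup>-n\<^esup> B \<noteq> {}}\<close> form a filter base. If \<open>m\<close>
  takes a point of \<open>A\<close> to \<open>U\<close> and a point of \<open>B\<close> to \<open>V\<close>, then a time from \<open>A \<inter> T\<^bsup>-m\<^esup> U\<close> to \<open>B \<inter> T\<^bsup>-m\<^esup> V\<close>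
  is a time from \<open>A\<close> to \<open>B\<close> and also, since the iterates commute, from \<open>U\<close> to \<open>V\<close>.
\<close>

lemma common_hitting_time_finite:
  assumes "finite I"
    and "\<And>i. i \<in> I \<Longrightarrow> open (U i)" "\<And>i. i \<in> I \<Longrightarrow> open (V i)"
    and "\<And>i. i \<in> I \<Longrightarrow> U i \<noteq> {}" "\<And>i. i \<in> I \<Longrightarrow> V i \<noteq> {}"
  obtains n where "\<And>i. i \<in> I \<Longrightarrow> \<exists>x\<in>U i. int_iter T n x \<in> V i"
proof -
  have "\<exists>A B. open A \<and> open B \<and> A \<noteq> {} \<and> B \<noteq> {} \<and>
    (\<forall>n. (\<exists>x\<in>A. int_iter T n x \<in> B) \<longrightarrow> (\<forall>i\<in>I. \<exists>x\<in>U i. int_iter T n x \<in> V i))"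
    using assms
  proof (induction rule: finite_induct)
    case empty
    show ?case by (intro exI [of _ UNIV]) auto
  next
    case (insert i I)
    have IH: "\<exists>A B. open A \<and> open B \<and> A \<noteq> {} \<and> B \<noteq> {} \<and>
      (\<forall>n. (\<exists>x\<in>A. int_iter T n x \<in> B) \<longrightarrow> (\<forall>i\<in>I. \<exists>x\<in>U i. int_iter T n x \<in> V i))"
      by (rule insert.IH) (use insert.prems in auto)
    then obtain A B where AB: "open A" "open B" "A \<noteq> {}" "B \<noteq> {}"
      "\<And>n x i. x \<in> A \<Longrightarrow> int_iter T n x \<in> B \<Longrightarrow> i \<in> I \<Longrightarrow> \<exists>x\<in>U i. int_iter T n x \<in> V i"
      by blast
    have i: "open (U i)" "open (V i)" "U i \<noteq> {}" "V i \<noteq> {}" using insert.prems by auto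
    obtain m a b where m: "a \<in> A" "int_iter T m a \<in> U i" "b \<in> B" "int_iter T m b \<in> V i"
      using common_hitting_time [OF AB(1) i(1) AB(2) i(2) AB(3) i(3) AB(4) i(4)] by blast
    define A' B' where "A' = A \<inter> int_iter T m -` U i" and "B' = B \<inter> int_iter T m -` V i"
    have "open A'" "open B'" "A' \<noteq> {}" "B' \<noteq> {}"
      unfolding A'_def B'_def using AB i m by (auto intro!: open_Int open_int_iter_vimage)
    moreover have "\<exists>x\<in>U j. int_iter T n x \<in> V j"
      if x: "x \<in> A'" "int_iter T n x \<in> B'" and j: "j \<in> insert i I" for n x j
    proof (cases "j = i")
      case True
      have "int_iter T n (int_iter T m x) = int_iter T m (int_iter T n x)"
        by (metis add.commute bij_T int_iter_add)
      then show ?thesis using x True by (auto simp: A'_def B'_def intro!: bexI [of _ "int_iter T m x"])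
    next
      case False
      then show ?thesis using AB(5) [of x n j] x j by (auto simp: A'_def B'_def)
    qed
    ultimately show ?case by (intro exI [of _ A'] exI [of _ B']) blast
  qed
  then obtain A B where AB: "open A" "open B" "A \<noteq> {}" "B \<noteq> {}"
    "\<And>n x i. x \<in> A \<Longrightarrow> int_iter T n x \<in> B \<Longrightarrow> i \<in> I \<Longrightarrow> \<exists>x\<in>U i. int_iter T n x \<in> V i"
    by blast
  obtain n x where "x \<in> A" "int_iter T n x \<in> B"
    using common_hitting_time [OF AB(1,2) AB(1,2) AB(3,4) AB(3,4)] by blast
  then show ?thesis using that AB(5) by blast
qed

text \<open>
  Choose the last step \<open>m\<close> of the cube as a common time from the sets at the lower face to the sets
  opposite to them. The points that serve a vertex and its opposite vertex at once form
  nonempty open sets, indexed by a cube of one dimension less.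
\<close>

lemma cube_visits_open_sets:
  assumes "\<And>\<epsilon>. \<epsilon> \<in> cube d \<Longrightarrow> open (U \<epsilon>)" "\<And>\<epsilon>. \<epsilon> \<in> cube d \<Longrightarrow> U \<epsilon> \<noteq> {}"
  shows "\<exists>w n. \<forall>\<epsilon>\<in>cube d. int_iter T (cube_dot d n \<epsilon>) w \<in> U \<epsilon>"
  using assms
proof (induction d arbitrary: U)
  case 0
  have "cube 0 = {cube_zero 0}" by (simp add: cube_def cube_zero_def restrict_def)
  then show ?case using 0 by (auto simp: cube_dot_def)
next
  case (Suc d)
  define l u where "l = (\<lambda>\<epsilon> :: nat \<Rightarrow> int. \<epsilon>(Suc d := 0))" and "u = (\<lambda>\<epsilon> :: nat \<Rightarrow> int. \<epsilon>(Suc d := 1))"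
  have lu: "l \<epsilon> \<in> cube (Suc d)" "u \<epsilon> \<in> cube (Suc d)" if "\<epsilon> \<in> cube d" for \<epsilon>
    using that by (auto simp: l_def u_def cube_def PiE_iff extensional_def)
  obtain m where m: "\<And>\<epsilon>. \<epsilon> \<in> cube d \<Longrightarrow> \<exists>x\<in>U (l \<epsilon>). int_iter T m x \<in> U (u \<epsilon>)"
    using common_hitting_time_finite [of "cube d" "\<lambda>\<epsilon>. U (l \<epsilon>)" "\<lambda>\<epsilon>. U (u \<epsilon>)"] Suc.prems lu
    by (metis finite_cube)
  have "\<exists>w n. \<forall>\<epsilon>\<in>cube d. int_iter T (cube_dot d n \<epsilon>) w \<in> U (l \<epsilon>) \<inter> int_iter T m -` U (u \<epsilon>)"
  proof (rule Suc.IH)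
    fix \<epsilon> assume \<epsilon>: "\<epsilon> \<in> cube d"
    then show "open (U (l \<epsilon>) \<inter> int_iter T m -` U (u \<epsilon>))"
      using Suc.prems(1) lu by (auto intro!: open_Int open_int_iter_vimage)
    show "U (l \<epsilon>) \<inter> int_iter T m -` U (u \<epsilon>) \<noteq> {}"
      using m [OF \<epsilon>] by blast
  qed
  then obtain w n where wn: "\<And>\<epsilon>. \<epsilon> \<in> cube d \<Longrightarrow>
      int_iter T (cube_dot d n \<epsilon>) w \<in> U (l \<epsilon>) \<inter> int_iter T m -` U (u \<epsilon>)"
    by blast
  have "int_iter T (cube_dot (Suc d) (n(Suc d := m)) \<epsilon>) w \<in> U \<epsilon>" if \<epsilon>: "\<epsilon> \<in> cube (Suc d)" for \<epsilon>
  proof -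
    define \<epsilon>' where "\<epsilon>' = restrict \<epsilon> {1..d}"
    have \<epsilon>': "\<epsilon>' \<in> cube d" using \<epsilon> by (auto simp: \<epsilon>'_def cube_def PiE_iff)
    have dot: "cube_dot (Suc d) (n(Suc d := m)) \<epsilon> = m * \<epsilon> (Suc d) + cube_dot d n \<epsilon>'"
      by (simp add: cube_dot_def \<epsilon>'_def)
    have "\<epsilon> (Suc d) = 0 \<or> \<epsilon> (Suc d) = 1" using cubeD [OF \<epsilon>] by simp
    then show ?thesis
    proof
      assume 0: "\<epsilon> (Suc d) = 0"
      then have "\<epsilon> = l \<epsilon>'"
        using \<epsilon> by (auto simp: \<epsilon>'_def l_def fun_eq_iff cube_def PiE_iff extensional_def)
      then show ?thesis using wn [OF \<epsilon>'] dot 0 by simp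
    next
      assume 1: "\<epsilon> (Suc d) = 1"
      then have "\<epsilon> = u \<epsilon>'"
        using \<epsilon> by (auto simp: \<epsilon>'_def u_def fun_eq_iff cube_def PiE_iff extensional_def)
      then show ?thesis using wn [OF \<epsilon>'] dot 1 by (simp add: int_iter_add [OF bij_T])
    qed
  qed
  then show ?case by blast
qed

lemma dynamical_cubes_weakly_mixing: "dynamical_cubes T d = UNIV"
proof -
  have "y \<in> dynamical_cubes T d" for y
  proof (rule dynamical_cubesI)
    fix \<delta> :: real assume "0 < \<delta>"
    then have "\<exists>w n. \<forall>\<epsilon>\<in>cube d. int_iter T (cube_dot d n \<epsilon>) w \<in> ball (y \<epsilon>) \<delta>"
      by (intro cube_visits_open_sets) auto
    then show "\<exists>w n. \<forall>\<epsilon>\<in>cube d. dist (int_iter T (cube_dot d n \<epsilon>) w) (y \<epsilon>) < \<delta>"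
      by (simp add: dist_commute)
  qed
  then show ?thesis by blast
qed

proposition one_point_factor_characteristic:
  "cubic_characteristic_factor d T (discrete_topology {()}) (\<lambda>u. u) (\<lambda>_. ())"
proof (rule cubic_characteristic_factorI)
  have "homeomorphic_map (discrete_topology {()}) (discrete_topology {()}) (\<lambda>u. u)"
    unfolding homeomorphic_eq_everything_map by (auto simp: open_map_def closed_map_def inj_on_def)
  then have "dynamical_system (discrete_topology {()}) (\<lambda>u. u)"
    unfolding dynamical_system_def by (simp add: compact_space_discrete_topology)
  then show "factor_map euclidean T (discrete_topology {()}) (\<lambda>u. u) (\<lambda>_. ())"
    using system by (auto simp: factor_map_def)
qed (simp add: dynamical_cubes_weakly_mixing)

end


section \<open>Idempotents in compact right topological semigroups\<close>

text \<open>
  A minimal closed subsemigroup \<open>N\<close> exists by Zorn's lemma and compactness. For \<open>u \<in> N\<close> the set \<open>N u\<close> is again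
  a closed subsemigroup, hence all of \<open>N\<close>; so some \<open>v\<close> satisfies \<open>v u = u\<close>. The solutions \<open>v\<close> form a closed
  subsemigroup in turn, hence all of \<open>N\<close>, and \<open>u\<close> itself is one of them.
\<close>

lemma Ellis_Numakura:
  fixes m :: "'b::t2_space \<Rightarrow> 'b \<Rightarrow> 'b"
  assumes "compact S" "S \<noteq> {}"
    and closed: "\<And>x y. x \<in> S \<Longrightarrow> y \<in> S \<Longrightarrow> m x y \<in> S"
    and assoc: "\<And>x y z. x \<in> S \<Longrightarrow> y \<in> S \<Longrightarrow> z \<in> S \<Longrightarrow> m (m x y) z = m x (m y z)"
    and cont: "\<And>y. y \<in> S \<Longrightarrow> continuous_on S (\<lambda>x. m x y)"
  obtains u where "u \<in> S" "m u u = u"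
proof -
  \<comment> \<open>Zorn's lemma yields maximal sets and is therefore applied to complements.\<close>
  define sub where "sub = (\<lambda>N. closed N \<and> N \<subseteq> S \<and> N \<noteq> {} \<and> (\<forall>x\<in>N. \<forall>y\<in>N. m x y \<in> N))"
  have "\<exists>M\<in>{X. sub (- X)}. \<forall>X\<in>{X. sub (- X)}. M \<subseteq> X \<longrightarrow> X = M"
  proof (rule subset_Zorn_nonempty)
    have "sub S" using assms(1,2) closed by (simp add: sub_def compact_imp_closed)
    then have "- S \<in> {X. sub (- X)}" by simp
    then show "{X. sub (- X)} \<noteq> {}" by blast
  next
    fix \<C> assume "\<C> \<noteq> {}" and chain: "subset.chain {X. sub (- X)} \<C>"
    then have sub: "sub (- X)" if "X \<in> \<C>" for X using that by (auto simp: subset_chain_def)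
    have "S \<inter> (\<Inter>X\<in>\<C>. - X) \<noteq> {}"
    proof (rule compact_imp_fip_image [OF \<open>compact S\<close>])
      show "closed (- X)" if "X \<in> \<C>" for X using sub [OF that] by (simp add: sub_def)
      fix \<C>' assume fin: "finite \<C>'" "\<C>' \<subseteq> \<C>"
      show "S \<inter> (\<Inter>X\<in>\<C>'. - X) \<noteq> {}"
      proof (cases "\<C>' = {}")
        case True
        then show ?thesis using \<open>S \<noteq> {}\<close> by simp
      next
        case False
        have "subset.chain \<C> \<C>'" using fin chain unfolding subset_chain_def by blast
        then have "\<Union>\<C>' \<in> \<C>'" using fin(1) False by (intro Union_in_chain)
        then have "sub (- \<Union>\<C>')" using sub fin by blast
        then have "- \<Union>\<C>' \<subseteq> S \<and> - \<Union>\<C>' \<noteq> {}" unfolding sub_def by (elim conjE) (rule conjI)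
        then obtain x where "x \<in> S" "x \<notin> \<Union>\<C>'" by (metis Compl_iff ex_in_conv subsetD)
        then have "x \<in> S \<inter> (\<Inter>X\<in>\<C>'. - X)" by simp
        then show ?thesis by blast
      qed
    qed
    then obtain x where "\<And>X. X \<in> \<C> \<Longrightarrow> x \<in> - X" by blast
    then have "x \<in> - \<Union>\<C>" by blast
    then have "- \<Union>\<C> \<noteq> {}" by blast
    moreover have "- \<Union>\<C> \<subseteq> S"
    proof -
      obtain X where "X \<in> \<C>" using \<open>\<C> \<noteq> {}\<close> by blast
      then have "- X \<subseteq> S" using sub [of X] by (simp add: sub_def)
      then show ?thesis using \<open>X \<in> \<C>\<close> by blast
    qed
    moreover have "closed (- \<Union>\<C>)"
      unfolding closed_def double_complement
      by (rule open_Union) (use sub in \<open>simp add: sub_def closed_def\<close>)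
    moreover have "m x y \<in> - \<Union>\<C>" if "x \<in> - \<Union>\<C>" "y \<in> - \<Union>\<C>" for x y
    proof -
      have "m x y \<in> - X" if "X \<in> \<C>" for X
      proof -
        have "x \<in> - X" "y \<in> - X" using \<open>x \<in> - \<Union>\<C>\<close> \<open>y \<in> - \<Union>\<C>\<close> that by blast+
        then show ?thesis using sub [OF that] by (simp add: sub_def)
      qed
      then show ?thesis by blast
    qed
    ultimately show "\<Union>\<C> \<in> {X. sub (- X)}"
      unfolding mem_Collect_eq sub_def by (intro conjI ballI)
  qed
  then obtain M where M: "sub (- M)" "\<And>X. sub (- X) \<Longrightarrow> M \<subseteq> X \<Longrightarrow> X = M" by blast
  define N where "N = - M"
  have N: "closed N" "N \<subseteq> S" "N \<noteq> {}" "\<And>x y. x \<in> N \<Longrightarrow> y \<in> N \<Longrightarrow> m x y \<in> N"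
    using M(1) by (auto simp: sub_def N_def)
  have minimal: "K = N" if "sub K" "K \<subseteq> N" for K
    using M(2) [of "- K"] that by (auto simp: N_def)
  have "compact N" using N(1,2) \<open>compact S\<close> by (metis closed_Int_compact inf.absorb_iff1)
  obtain u where u: "u \<in> N" using N by blast
  have cont_u: "continuous_on N (\<lambda>x. m x u)" using cont continuous_on_subset N u by blast
  have "(\<lambda>x. m x u) ` N = N"
  proof (rule minimal)
    have into_N: "(\<lambda>x. m x u) ` N \<subseteq> N" using N(4) u by auto
    have mult: "m (m x u) (m y u) \<in> (\<lambda>x. m x u) ` N" if "x \<in> N" "y \<in> N" for x y
    proof (rule image_eqI)
      show "m (m x u) (m y u) = m (m (m x u) y) u"
        using that u N(2,4) assoc by (metis subsetD)
      show "m (m x u) y \<in> N" using that u N(4) by blast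
    qed
    show "sub ((\<lambda>x. m x u) ` N)"
      unfolding sub_def
    proof (intro conjI)
      show "closed ((\<lambda>x. m x u) ` N)"
        using compact_continuous_image [OF cont_u \<open>compact N\<close>] by (rule compact_imp_closed)
      show "(\<lambda>x. m x u) ` N \<subseteq> S" using into_N N(2) by (rule subset_trans)
      show "(\<lambda>x. m x u) ` N \<noteq> {}" using N(3) by simp
      show "\<forall>x\<in>(\<lambda>x. m x u) ` N. \<forall>y\<in>(\<lambda>x. m x u) ` N. m x y \<in> (\<lambda>x. m x u) ` N"
        using mult by simp
    qed
  qed (use N u in auto)
  then obtain v where v: "v \<in> N" "m v u = u" using u by (metis imageE)
  have "{x \<in> N. m x u = u} = N"
  proof (rule minimal)
    have "closed (N \<inter> (\<lambda>x. m x u) -` {u})"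
      by (rule continuous_closed_preimage [OF cont_u N(1) closed_singleton])
    moreover have "{x \<in> N. m x u = u} = N \<inter> (\<lambda>x. m x u) -` {u}" by auto
    ultimately have "closed {x \<in> N. m x u = u}" by (simp only:)
    moreover have "{x \<in> N. m x u = u} \<subseteq> S" using N(2) by blast
    moreover have "{x \<in> N. m x u = u} \<noteq> {}" using v by blast
    moreover have "m x y \<in> {x \<in> N. m x u = u}"
      if xy: "x \<in> {x \<in> N. m x u = u}" "y \<in> {x \<in> N. m x u = u}" for x y
    proof -
      have "m (m x y) u = m x (m y u)" using xy u N(2) by (intro assoc) auto
      then show ?thesis using xy N(4) by simp
    qed
    ultimately show "sub {x \<in> N. m x u = u}"
      unfolding sub_def by (intro conjI ballI)
  qed auto
  then have "m u u = u" using u by blast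
  then show ?thesis using that u N(2) by blast
qed

section \<open>The enveloping group of a distal system\<close>

text \<open>
  Ellis-Numakura is applied to families of functions, which therefore have to be a Hausdorff space. The
  superclasses \<open>t0_space\<close> and \<open>t1_space\<close> are instantiated on the way, with the same argument sort.
\<close>

lemma hausdorff_fun:
  fixes f g :: "'i \<Rightarrow> 'b::t2_space"
  assumes "f \<noteq> g"
  shows "\<exists>U V. open U \<and> open V \<and> f \<in> U \<and> g \<in> V \<and> U \<inter> V = {}"
proof -
  obtain i where "f i \<noteq> g i" using assms by blast
  then obtain U V where UV: "open U" "open V" "f i \<in> U" "g i \<in> V" "U \<inter> V = {}"
    using hausdorff by metis
  have "open {h :: 'i \<Rightarrow> 'b. h i \<in> W}" if "open W" for W
    using product_topology_basis' [of "{i}" "\<lambda>_. W" "\<lambda>i. i"] that by simp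
  then show ?thesis
    using UV by (intro exI [of _ "{h. h i \<in> U}"] exI [of _ "{h. h i \<in> V}"]) auto
qed

instance "fun" :: (type, t2_space) t0_space
  by standard (use hausdorff_fun in blast)

instance "fun" :: (type, t2_space) t1_space
  by standard (use hausdorff_fun in blast)

instance "fun" :: (type, t2_space) t2_space
  by standard (rule hausdorff_fun)

lemma compact_UNIV_fun:
  assumes "compact (UNIV :: 'b::topological_space set)"
  shows "compact (UNIV :: ('i \<Rightarrow> 'b) set)"
proof -
  have "compact_space (euclidean :: 'b topology)"
    using assms by (simp add: compact_space_def)
  then have "compact_space (product_topology (\<lambda>i::'i. euclidean :: 'b topology) UNIV)"
    by (simp add: compact_space_product_topology)
  then show ?thesis by (simp add: euclidean_product_topology compact_space_def)
qed

lemma continuous_on_apply2: "continuous_on S (\<lambda>p :: 'i \<Rightarrow> 'j \<Rightarrow> 'b::topological_space. p i j)"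
  by (rule continuous_on_product_then_coordinatewise [OF continuous_on_product_then_coordinatewise [OF continuous_on_id]])

text \<open>
  The enveloping semigroup of the action of \<open>A \<subseteq> \<int>\<^sup>I\<close> on \<open>X\<^sup>I\<close>, in the topology of pointwise
  convergence. Its elements act on each coordinate separately, so they are kept as families of maps of
  \<open>X\<close> instead of maps of \<open>X\<^sup>I\<close>.
\<close>

definition ellis :: "('a::topological_space \<Rightarrow> 'a) \<Rightarrow> ('i \<Rightarrow> int) set \<Rightarrow> ('i \<Rightarrow> 'a \<Rightarrow> 'a) set" where
  "ellis T A = closure ((\<lambda>a i. int_iter T (a i)) ` A)"

lemma closed_ellis: "closed (ellis T A)"
  by (simp add: ellis_def)

lemma int_iter_in_ellis: "a \<in> A \<Longrightarrow> (\<lambda>i. int_iter T (a i)) \<in> ellis T A"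
  unfolding ellis_def by (intro subsetD [OF closure_subset] imageI)

lemma ellis_comp_right:
  assumes "\<And>a. a \<in> A \<Longrightarrow> a \<circ> \<phi> \<in> B" "p \<in> ellis T A"
  shows "p \<circ> \<phi> \<in> ellis T B"
proof -
  have "(\<lambda>p. p \<circ> \<phi>) ` closure ((\<lambda>a i. int_iter T (a i)) ` A) \<subseteq> ellis T B"
  proof (rule image_closure_subset [OF _ closed_ellis])
    show "continuous_on (closure ((\<lambda>a i. int_iter T (a i)) ` A)) (\<lambda>p. p \<circ> \<phi>)"
      unfolding comp_def
      by (intro continuous_on_coordinatewise_then_product continuous_on_apply2)
    show "(\<lambda>p. p \<circ> \<phi>) ` (\<lambda>a i. int_iter T (a i)) ` A \<subseteq> ellis T B"
      using int_iter_in_ellis [OF assms(1), of _ T] by (auto simp: comp_def)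
  qed
  then show ?thesis using assms(2) by (auto simp: ellis_def)
qed

lemma ellis_approx:
  fixes T :: "'a::metric_space \<Rightarrow> 'a"
  assumes "p \<in> ellis T A" "finite F" "0 < e"
  obtains a where "a \<in> A" "\<And>i v. (i, v) \<in> F \<Longrightarrow> dist (int_iter T (a i) v) (p i v) < e"
proof -
  define W where "W = (\<Inter>(i, v)\<in>F. {f. dist (f i v) (p i v) < e})"
  have "open {f :: 'b \<Rightarrow> 'a \<Rightarrow> 'a. dist (f i v) (p i v) < e}" for i v
    by (intro open_Collect_less continuous_on_dist continuous_on_apply2 continuous_on_const)
  then have "open W" unfolding W_def using assms(2) by (auto intro!: open_INT)
  moreover have "p \<in> W" using assms(3) by (auto simp: W_def)
  ultimately have "W \<inter> (\<lambda>a i. int_iter T (a i)) ` A \<noteq> {}"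
    using assms(1) unfolding ellis_def by (metis IntI empty_iff open_Int_closure_eq_empty)
  then show ?thesis using that by (auto simp: W_def)
qed

context compact_system
begin

lemma compact_ellis: "compact (ellis T A)"
  using compact_UNIV_fun [OF compact_UNIV_fun [OF compact_UNIV]] closed_ellis
  by (metis closed_Int_compact inf_top.right_neutral)

text \<open>
  Composition is continuous in the left factor always, but in the right factor only if the left factor
  is continuous. So \<open>q\<close> is approximated first with an iterate on the left, and then the left factor
  is approximated.
\<close>

lemma ellis_mult:
  assumes add: "\<And>a b. a \<in> A \<Longrightarrow> b \<in> A \<Longrightarrow> (\<lambda>i. a i + b i) \<in> A"
    and "p \<in> ellis T A" "q \<in> ellis T A"
  shows "(\<lambda>i. p i \<circ> q i) \<in> ellis T A"
proof -
  let ?S = "(\<lambda>a i. int_iter T (a i)) ` A"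
  have *: "(\<lambda>i. int_iter T (a i) \<circ> q i) \<in> ellis T A" if "a \<in> A" "q \<in> ellis T A" for a q
  proof -
    have "(\<lambda>q i. int_iter T (a i) \<circ> q i) ` closure ?S \<subseteq> ellis T A"
    proof (rule image_closure_subset [OF _ closed_ellis])
      have "continuous_on X (\<lambda>q. int_iter T (a i) (q i v))" for X i v
        by (rule continuous_on_compose2 [OF continuous_int_iter continuous_on_apply2]) auto
      then show "continuous_on (closure ?S) (\<lambda>q i. int_iter T (a i) \<circ> q i)"
        unfolding comp_def
        by (intro continuous_on_coordinatewise_then_product)
      show "(\<lambda>q i. int_iter T (a i) \<circ> q i) ` ?S \<subseteq> ellis T A"
      proof clarify
        fix b assume "b \<in> A"
        have "(\<lambda>i. int_iter T (a i) \<circ> int_iter T (b i)) = (\<lambda>i. int_iter T (a i + b i))"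
          by (simp add: fun_eq_iff int_iter_add [OF bij_T])
        then show "(\<lambda>i. int_iter T (a i) \<circ> int_iter T (b i)) \<in> ellis T A"
          using int_iter_in_ellis [OF add [OF \<open>a \<in> A\<close> \<open>b \<in> A\<close>], of T] by simp
      qed
    qed
    then show ?thesis using \<open>q \<in> ellis T A\<close> by (auto simp: ellis_def)
  qed
  have "(\<lambda>p i. p i \<circ> q i) ` closure ?S \<subseteq> ellis T A"
  proof (rule image_closure_subset [OF _ closed_ellis])
    show "continuous_on (closure ?S) (\<lambda>p i. p i \<circ> q i)"
      unfolding comp_def
      by (intro continuous_on_coordinatewise_then_product continuous_on_apply2)
    show "(\<lambda>p i. p i \<circ> q i) ` ?S \<subseteq> ellis T A"
      using * assms(3) by auto
  qed
  then show ?thesis using assms(2) by (auto simp: ellis_def)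
qed

end

locale distal_system = compact_system +
  assumes distal: "distal T"
begin

lemma proximal_imp_eq:
  assumes "\<And>\<delta>. 0 < \<delta> \<Longrightarrow> \<exists>n. dist (int_iter T n x) (int_iter T n y) < \<delta>"
  shows "x = y"
proof (rule ccontr)
  assume "x \<noteq> y"
  then have pos: "0 < (INF n. dist (int_iter T n x) (int_iter T n y))"
    using distal by (simp add: distal_def)
  have "(INF n. dist (int_iter T n x) (int_iter T n y)) \<le> dist (int_iter T n x) (int_iter T n y)" for n
    by (intro cINF_lower bdd_belowI [of _ 0]) auto
  then show False using assms [OF pos] by (meson not_le)
qed

text \<open>
  If \<open>u\<close> is idempotent, a point and its image under \<open>u\<close> have the same image under \<open>u\<close>. Iterates that
  approximate \<open>u\<close> at both points bring them arbitrarily close together.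
\<close>

lemma idempotent_ellis_eq_id:
  assumes "u \<in> ellis T A" "u i \<circ> u i = u i"
  shows "u i = id"
proof
  fix v
  define w where "w = u i v"
  have w: "u i w = w" using fun_cong [OF assms(2), of v] by (simp add: w_def)
  have "v = w"
  proof (rule proximal_imp_eq)
    fix \<delta> :: real assume "0 < \<delta>"
    obtain a where a: "a \<in> A" "\<And>j x. (j, x) \<in> {(i, v), (i, w)} \<Longrightarrow> dist (int_iter T (a j) x) (u j x) < \<delta> / 2"
      using ellis_approx [OF assms(1), of "{(i, v), (i, w)}" "\<delta> / 2"] \<open>0 < \<delta>\<close>
      by (metis finite.emptyI finite.insertI half_gt_zero)
    have "dist (int_iter T (a i) v) w < \<delta> / 2" "dist (int_iter T (a i) w) w < \<delta> / 2"
      using a(2) [of i v] a(2) [of i w] w by (simp_all add: w_def)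
    then show "\<exists>n. dist (int_iter T n v) (int_iter T n w) < \<delta>"
      using dist_triangle_half_l [of _ w] by (metis dist_commute)
  qed
  then show "u i v = id v" by (simp add: w_def)
qed

text \<open>
  The left ideal generated by \<open>p\<close> is a compact semigroup, so it contains an idempotent, which is the
  identity. Thus every element has a left inverse, and the semigroup is a group.
\<close>

lemma ellis_inverse:
  assumes add: "\<And>a b. a \<in> A \<Longrightarrow> b \<in> A \<Longrightarrow> (\<lambda>i. a i + b i) \<in> A"
    and "p \<in> ellis T A"
  obtains q where "q \<in> ellis T A" "\<And>i v. q i (p i v) = v" "\<And>i v. p i (q i v) = v"
proof -
  let ?m = "\<lambda>p q :: 'b \<Rightarrow> 'a \<Rightarrow> 'a. \<lambda>i. p i \<circ> q i"
  have cont: "continuous_on S (\<lambda>p. ?m p q)" for S q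
    unfolding comp_def by (intro continuous_on_coordinatewise_then_product continuous_on_apply2)
  have left: "\<exists>q\<in>ellis T A. \<forall>i. q i \<circ> p i = id" if p: "p \<in> ellis T A" for p
  proof -
    let ?S = "(\<lambda>q. ?m q p) ` ellis T A"
    have "?S \<subseteq> ellis T A" using ellis_mult [OF add] p by blast
    obtain u where u: "u \<in> ?S" "?m u u = u"
    proof (rule Ellis_Numakura [of ?S ?m])
      show "compact ?S" by (intro compact_continuous_image cont compact_ellis)
      show "?S \<noteq> {}" using p by blast
      show "?m x y \<in> ?S" if "x \<in> ?S" "y \<in> ?S" for x y
      proof -
        obtain y' where y': "y' \<in> ellis T A" "y = ?m y' p" using \<open>y \<in> ?S\<close> by blast
        have x: "x \<in> ellis T A" using \<open>x \<in> ?S\<close> \<open>?S \<subseteq> ellis T A\<close> by (rule subsetD [rotated])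
        have "?m x y = ?m (?m x y') p" using y' by (simp add: comp_assoc)
        then show ?thesis using ellis_mult [OF add x y'(1)] by (rule image_eqI)
      qed
    qed (auto simp: cont comp_assoc)
    obtain q where q: "q \<in> ellis T A" "u = ?m q p" using u(1) by blast
    have "u i = id" for i
    proof (rule idempotent_ellis_eq_id)
      show "u \<in> ellis T A" using u(1) \<open>?S \<subseteq> ellis T A\<close> by (rule subsetD [rotated])
      show "u i \<circ> u i = u i" using fun_cong [OF u(2), of i] by simp
    qed
    then have "q i \<circ> p i = id" for i using fun_cong [OF q(2), of i] by simp
    then show ?thesis using q(1) by blast
  qed
  obtain q where q: "q \<in> ellis T A" "\<And>i. q i \<circ> p i = id" using left [OF assms(2)] by blast
  obtain r where r: "\<And>i. r i \<circ> q i = id" using left [OF q(1)] by blast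
  have "p i = r i" for i
    using q(2) [of i] r [of i] by (metis comp_assoc comp_id id_comp)
  then have "p i \<circ> q i = id" for i using r by simp
  then show ?thesis using that q by (metis comp_apply id_apply)
qed

end


section \<open>Cubes of a minimal distal system\<close>

text \<open>
  The exponents of the cube group. The values outside \<open>cube d\<close> are left arbitrary, which makes the set
  closed under composition with every affine map of the cube.
\<close>

definition affine_cube_functions :: "nat \<Rightarrow> ((nat \<Rightarrow> int) \<Rightarrow> int) set" where
  "affine_cube_functions d = {a. \<exists>m n. \<forall>\<epsilon>\<in>cube d. a \<epsilon> = m + cube_dot d n \<epsilon>}"

lemma affine_cube_functions_add:
  assumes "a \<in> affine_cube_functions d" "b \<in> affine_cube_functions d"
  shows "(\<lambda>\<epsilon>. a \<epsilon> + b \<epsilon>) \<in> affine_cube_functions d"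
proof -
  obtain m n m' n' where mn: "\<And>\<epsilon>. \<epsilon> \<in> cube d \<Longrightarrow> a \<epsilon> = m + cube_dot d n \<epsilon>"
    "\<And>\<epsilon>. \<epsilon> \<in> cube d \<Longrightarrow> b \<epsilon> = m' + cube_dot d n' \<epsilon>"
    using assms unfolding affine_cube_functions_def by blast
  have "\<forall>\<epsilon>\<in>cube d. a \<epsilon> + b \<epsilon> = (m + m') + cube_dot d (\<lambda>i. n i + n' i) \<epsilon>"
    using mn by (simp add: cube_dot_add)
  then show ?thesis unfolding affine_cube_functions_def by blast
qed

lemma const_in_affine_cube_functions: "(\<lambda>_. m) \<in> affine_cube_functions d"
proof -
  have "\<forall>\<epsilon>\<in>cube d. m = m + cube_dot d (\<lambda>_. 0) \<epsilon>" by simp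
  then show ?thesis unfolding affine_cube_functions_def by blast
qed

lemma cube_dot_in_affine_cube_functions: "cube_dot d n \<in> affine_cube_functions d"
proof -
  have "\<forall>\<epsilon>\<in>cube d. cube_dot d n \<epsilon> = 0 + cube_dot d n \<epsilon>" by simp
  then show ?thesis unfolding affine_cube_functions_def by blast
qed

definition affine_cube_map :: "nat \<Rightarrow> ((nat \<Rightarrow> int) \<Rightarrow> nat \<Rightarrow> int) \<Rightarrow> bool" where
  "affine_cube_map d \<phi> \<longleftrightarrow> \<phi> ` cube d \<subseteq> cube d \<and> (\<forall>n. (\<lambda>\<epsilon>. cube_dot d n (\<phi> \<epsilon>)) \<in> affine_cube_functions d)"

lemma affine_cube_mapI:
  assumes "\<And>\<epsilon>. \<epsilon> \<in> cube d \<Longrightarrow> \<phi> \<epsilon> \<in> cube d"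
    and "\<And>\<epsilon> i. \<epsilon> \<in> cube d \<Longrightarrow> i \<in> {1..d} \<Longrightarrow> \<phi> \<epsilon> i = \<alpha> i + \<beta> i * \<epsilon> i"
  shows "affine_cube_map d \<phi>"
proof -
  have "(\<lambda>\<epsilon>. cube_dot d n (\<phi> \<epsilon>)) \<in> affine_cube_functions d" for n
  proof -
    have "cube_dot d n (\<phi> \<epsilon>) = (\<Sum>i\<in>{1..d}. n i * \<alpha> i) + cube_dot d (\<lambda>i. n i * \<beta> i) \<epsilon>"
      if "\<epsilon> \<in> cube d" for \<epsilon>
    proof -
      have "cube_dot d n (\<phi> \<epsilon>) = (\<Sum>i\<in>{1..d}. n i * \<alpha> i + n i * \<beta> i * \<epsilon> i)"
        unfolding cube_dot_def using assms(2) [OF that] by (intro sum.cong) (auto simp: algebra_simps)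
      then show ?thesis by (simp add: cube_dot_def sum.distrib)
    qed
    then show ?thesis unfolding affine_cube_functions_def by blast
  qed
  then show ?thesis using assms(1) by (auto simp: affine_cube_map_def)
qed

lemma affine_cube_map_comp:
  assumes "affine_cube_map d \<phi>" "a \<in> affine_cube_functions d"
  shows "a \<circ> \<phi> \<in> affine_cube_functions d"
proof -
  obtain m n where a: "\<And>\<epsilon>. \<epsilon> \<in> cube d \<Longrightarrow> a \<epsilon> = m + cube_dot d n \<epsilon>"
    using assms(2) unfolding affine_cube_functions_def by blast
  have "(\<lambda>\<epsilon>. cube_dot d n (\<phi> \<epsilon>)) \<in> affine_cube_functions d"
    using assms(1) by (simp add: affine_cube_map_def)
  then obtain m' n' where \<phi>: "\<And>\<epsilon>. \<epsilon> \<in> cube d \<Longrightarrow> cube_dot d n (\<phi> \<epsilon>) = m' + cube_dot d n' \<epsilon>"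
    unfolding affine_cube_functions_def by blast
  have "\<forall>\<epsilon>\<in>cube d. (a \<circ> \<phi>) \<epsilon> = (m + m') + cube_dot d n' \<epsilon>"
  proof
    fix \<epsilon> assume \<epsilon>: "\<epsilon> \<in> cube d"
    then have "\<phi> \<epsilon> \<in> cube d" using assms(1) by (auto simp: affine_cube_map_def)
    then show "(a \<circ> \<phi>) \<epsilon> = (m + m') + cube_dot d n' \<epsilon>" using a \<phi> [OF \<epsilon>] by simp
  qed
  then show ?thesis unfolding affine_cube_functions_def by blast
qed

lemma cube_upd: "\<epsilon> \<in> cube d \<Longrightarrow> j \<in> {1..d} \<Longrightarrow> c = 0 \<or> c = 1 \<Longrightarrow> \<epsilon>(j := c) \<in> cube d"
  by (auto simp: cube_def PiE_iff extensional_def)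

lemma affine_cube_map_upd:
  assumes "j \<in> {1..d}" "c = 0 \<or> c = 1"
  shows "affine_cube_map d (\<lambda>\<epsilon>. \<epsilon>(j := c))"
  using assms cube_upd
  by (intro affine_cube_mapI [where \<alpha> = "\<lambda>i. if i = j then c else 0" and \<beta> = "\<lambda>i. if i = j then 0 else 1"]) auto

lemma affine_cube_map_flip:
  assumes "j \<in> {1..d}"
  shows "affine_cube_map d (\<lambda>\<epsilon>. \<epsilon>(j := 1 - \<epsilon> j))"
proof (rule affine_cube_mapI [where \<alpha> = "\<lambda>i. if i = j then 1 else 0" and \<beta> = "\<lambda>i. if i = j then - 1 else 1"])
  fix \<epsilon> assume \<epsilon>: "\<epsilon> \<in> cube d"
  show "\<epsilon>(j := 1 - \<epsilon> j) \<in> cube d"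
    using cubeD [OF \<epsilon> assms] by (intro cube_upd \<epsilon> assms) auto
qed auto

text \<open>
  The reflection that exchanges the base vertex and \<open>c\<close>: it replaces \<open>\<epsilon> i\<close> by \<open>1 - \<epsilon> i\<close> where
  \<open>c i = 1\<close>.
\<close>

lemma affine_cube_map_reflect:
  assumes "c \<in> cube d"
  shows "affine_cube_map d (\<lambda>\<epsilon>. \<lambda>i\<in>{1..d}. c i + (1 - 2 * c i) * \<epsilon> i)"
proof (rule affine_cube_mapI)
  fix \<epsilon> assume "\<epsilon> \<in> cube d"
  then show "(\<lambda>i\<in>{1..d}. c i + (1 - 2 * c i) * \<epsilon> i) \<in> cube d"
    using cubeD [of \<epsilon> d] cubeD [OF assms] by (fastforce simp: cube_def PiE_iff)
qed simp

context compact_system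
begin

lemma dynamical_cubes_comp:
  assumes "affine_cube_map d \<phi>" "y \<in> dynamical_cubes T d"
  shows "(\<lambda>\<epsilon>. y (\<phi> \<epsilon>)) \<in> dynamical_cubes T d"
proof (rule dynamical_cubesI)
  fix \<delta> :: real assume "0 < \<delta>"
  obtain w n where w: "\<And>\<epsilon>. \<epsilon> \<in> cube d \<Longrightarrow> dist (int_iter T (cube_dot d n \<epsilon>) w) (y \<epsilon>) < \<delta>"
    using dynamical_cubesE [OF assms(2) \<open>0 < \<delta>\<close>] by blast
  have "(\<lambda>\<epsilon>. cube_dot d n (\<phi> \<epsilon>)) \<in> affine_cube_functions d"
    using assms(1) by (simp add: affine_cube_map_def)
  then obtain m n' where \<phi>: "\<And>\<epsilon>. \<epsilon> \<in> cube d \<Longrightarrow> cube_dot d n (\<phi> \<epsilon>) = m + cube_dot d n' \<epsilon>"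
    unfolding affine_cube_functions_def by blast
  have "dist (int_iter T (cube_dot d n' \<epsilon>) (int_iter T m w)) (y (\<phi> \<epsilon>)) < \<delta>" if "\<epsilon> \<in> cube d" for \<epsilon>
  proof -
    have "\<phi> \<epsilon> \<in> cube d" using assms(1) that by (auto simp: affine_cube_map_def)
    then have "dist (int_iter T (cube_dot d n' \<epsilon> + m) w) (y (\<phi> \<epsilon>)) < \<delta>"
      using w [of "\<phi> \<epsilon>"] \<phi> [OF that] by (simp add: add.commute)
    then show ?thesis by (simp add: int_iter_add [OF bij_T])
  qed
  then show "\<exists>w n. \<forall>\<epsilon>\<in>cube d. dist (int_iter T (cube_dot d n \<epsilon>) w) (y (\<phi> \<epsilon>)) < \<delta>" by blast
qed

lemma const_in_dynamical_cubes: "(\<lambda>_. x) \<in> dynamical_cubes T d"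
proof (rule dynamical_cubesI)
  fix \<delta> :: real assume "0 < \<delta>"
  then have "\<forall>\<epsilon>\<in>cube d. dist (int_iter T (cube_dot d (\<lambda>_. 0) \<epsilon>) x) x < \<delta>" by simp
  then show "\<exists>w n. \<forall>\<epsilon>\<in>cube d. dist (int_iter T (cube_dot d n \<epsilon>) w) x < \<delta>" by blast
qed

end

locale minimal_distal_system = distal_system +
  assumes minimal: "minimal_system T"
begin

text \<open>
  The points \<open>p v\<close>, for \<open>p\<close> in the enveloping semigroup of \<open>T\<close> itself, form a compact set that contains the
  dense orbit of \<open>v\<close>. The one-element index type \<open>unit\<close> yields that semigroup, and composition with the
  map to \<open>unit\<close> turns its elements into constant families.
\<close>

lemma ellis_const_transitive:
  obtains r where "r \<in> ellis T (affine_cube_functions d)" "\<And>i. r i v = w"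
proof -
  have "w \<in> (\<lambda>p. p () v) ` ellis T UNIV"
  proof -
    have "range (\<lambda>n. int_iter T n v) \<subseteq> (\<lambda>p. p () v) ` ellis T UNIV"
    proof clarify
      fix n show "int_iter T n v \<in> (\<lambda>p. p () v) ` ellis T UNIV"
        using int_iter_in_ellis [of "\<lambda>_. n" UNIV T] by (intro image_eqI) auto
    qed
    moreover have "compact ((\<lambda>p. p () v) ` ellis T UNIV)"
      by (intro compact_continuous_image continuous_on_apply2 compact_ellis)
    ultimately have "closure (range (\<lambda>n. int_iter T n v)) \<subseteq> (\<lambda>p. p () v) ` ellis T UNIV"
      by (intro closure_minimal compact_imp_closed)
    moreover have "w \<in> closure (range (\<lambda>n. int_iter T n v))"
      using minimal by (simp add: minimal_system_def)
    ultimately show ?thesis by blast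
  qed
  then obtain p where p: "p \<in> ellis T UNIV" "p () v = w" by blast
  have "p \<circ> (\<lambda>_. ()) \<in> ellis T (affine_cube_functions d)"
    using p(1) by (rule ellis_comp_right [rotated]) (simp add: comp_def const_in_affine_cube_functions)
  then show ?thesis using that p(2) by simp
qed

abbreviation "E d \<equiv> ellis T (affine_cube_functions d)"

lemma E_mult: "p \<in> E d \<Longrightarrow> q \<in> E d \<Longrightarrow> (\<lambda>i. p i \<circ> q i) \<in> E d"
  by (rule ellis_mult [OF affine_cube_functions_add])

lemma E_inverse:
  assumes "p \<in> E d"
  obtains q where "q \<in> E d" "\<And>i v. q i (p i v) = v" "\<And>i v. p i (q i v) = v"
  by (rule ellis_inverse [OF affine_cube_functions_add assms]) (assumption | rule that)+

lemma E_comp: "affine_cube_map d \<phi> \<Longrightarrow> p \<in> E d \<Longrightarrow> p \<circ> \<phi> \<in> E d"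
  by (rule ellis_comp_right [OF affine_cube_map_comp])

text \<open>
  The cubes form a single orbit of the enveloping group, through any constant cube. For the harder
  direction, the elements of the group that take the constant cube to within \<open>\<delta>\<close> of \<open>y\<close> form nonempty
  closed sets, which shrink with \<open>\<delta>\<close>; compactness gives an element in all of them.
\<close>

lemma dynamical_cubes_iff_ellis:
  "y \<in> dynamical_cubes T d \<longleftrightarrow> (\<exists>p\<in>E d. \<forall>\<epsilon>\<in>cube d. p \<epsilon> w = y \<epsilon>)"
proof
  assume "\<exists>p\<in>E d. \<forall>\<epsilon>\<in>cube d. p \<epsilon> w = y \<epsilon>"
  then obtain p where p: "p \<in> E d" "\<And>\<epsilon>. \<epsilon> \<in> cube d \<Longrightarrow> p \<epsilon> w = y \<epsilon>" by blast
  show "y \<in> dynamical_cubes T d"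
  proof (rule dynamical_cubesI)
    fix \<delta> :: real assume "0 < \<delta>"
    obtain a where a: "a \<in> affine_cube_functions d"
      "\<And>\<epsilon> v. (\<epsilon>, v) \<in> (\<lambda>\<epsilon>. (\<epsilon>, w)) ` cube d \<Longrightarrow> dist (int_iter T (a \<epsilon>) v) (p \<epsilon> v) < \<delta>"
      using ellis_approx [OF p(1) finite_imageI [OF finite_cube] \<open>0 < \<delta>\<close>] by metis
    obtain m n where mn: "\<And>\<epsilon>. \<epsilon> \<in> cube d \<Longrightarrow> a \<epsilon> = m + cube_dot d n \<epsilon>"
      using a(1) unfolding affine_cube_functions_def by blast
    have "dist (int_iter T (cube_dot d n \<epsilon>) (int_iter T m w)) (y \<epsilon>) < \<delta>" if "\<epsilon> \<in> cube d" for \<epsilon>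
    proof -
      have "dist (int_iter T (cube_dot d n \<epsilon> + m) w) (y \<epsilon>) < \<delta>"
        using a(2) [of \<epsilon> w] mn [OF that] p(2) [OF that] that by (simp add: add.commute)
      then show ?thesis by (simp add: int_iter_add [OF bij_T])
    qed
    then show "\<exists>w n. \<forall>\<epsilon>\<in>cube d. dist (int_iter T (cube_dot d n \<epsilon>) w) (y \<epsilon>) < \<delta>" by blast
  qed
next
  assume y: "y \<in> dynamical_cubes T d"
  define K where "K = (\<lambda>\<delta>. {p :: (nat \<Rightarrow> int) \<Rightarrow> 'a \<Rightarrow> 'a. \<forall>\<epsilon>\<in>cube d. dist (p \<epsilon> w) (y \<epsilon>) \<le> \<delta>})"
  have "E d \<inter> (\<Inter>\<delta>\<in>{0<..}. K \<delta>) \<noteq> {}"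
  proof (rule compact_imp_fip_image [OF compact_ellis])
    fix \<delta> :: real
    have "closed {p :: (nat \<Rightarrow> int) \<Rightarrow> 'a \<Rightarrow> 'a. dist (p \<epsilon> w) (y \<epsilon>) \<le> \<delta>}" for \<epsilon>
      by (intro closed_Collect_le continuous_on_dist continuous_on_apply2 continuous_on_const)
    moreover have "K \<delta> = (\<Inter>\<epsilon>\<in>cube d. {p. dist (p \<epsilon> w) (y \<epsilon>) \<le> \<delta>})" by (auto simp: K_def)
    ultimately show "closed (K \<delta>)" by auto
  next
    fix I :: "real set" assume I: "finite I" "I \<subseteq> {0<..}"
    define \<delta> where "\<delta> = Min (insert 1 I)"
    have "0 < \<delta>" unfolding \<delta>_def using I by (subst Min_gr_iff) auto
    have \<delta>: "\<delta> \<le> \<delta>'" if "\<delta>' \<in> I" for \<delta>' unfolding \<delta>_def using that I(1) by (intro Min_le) auto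
    obtain w' n where w': "\<And>\<epsilon>. \<epsilon> \<in> cube d \<Longrightarrow> dist (int_iter T (cube_dot d n \<epsilon>) w') (y \<epsilon>) < \<delta>"
      using dynamical_cubesE [OF y \<open>0 < \<delta>\<close>] by blast
    obtain r where r: "r \<in> E d" "\<And>\<epsilon>. r \<epsilon> w = w'"
      by (rule ellis_const_transitive [of d w w']) (rule that)
    define p where "p = (\<lambda>\<epsilon>. int_iter T (cube_dot d n \<epsilon>) \<circ> r \<epsilon>)"
    have "p \<in> E d"
      unfolding p_def using int_iter_in_ellis [OF cube_dot_in_affine_cube_functions] r(1) by (rule E_mult)
    moreover have "dist (p \<epsilon> w) (y \<epsilon>) \<le> \<delta>'" if "\<epsilon> \<in> cube d" "\<delta>' \<in> I" for \<epsilon> \<delta>'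
      using w' [OF that(1)] \<delta> [OF that(2)] by (simp add: p_def r(2))
    ultimately have "p \<in> E d \<inter> (\<Inter>\<delta>\<in>I. K \<delta>)" by (simp add: K_def)
    then show "E d \<inter> (\<Inter>\<delta>\<in>I. K \<delta>) \<noteq> {}" by blast
  qed
  then obtain p where p: "p \<in> E d" "\<And>\<delta>. 0 < \<delta> \<Longrightarrow> p \<in> K \<delta>" by auto
  have "p \<epsilon> w = y \<epsilon>" if "\<epsilon> \<in> cube d" for \<epsilon>
  proof -
    have "dist (p \<epsilon> w) (y \<epsilon>) \<le> 0 + \<delta>" if "0 < \<delta>" for \<delta>
      using p(2) [OF that] \<open>\<epsilon> \<in> cube d\<close> by (simp add: K_def)
    then have "dist (p \<epsilon> w) (y \<epsilon>) \<le> 0" by (rule field_le_epsilon)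
    then show ?thesis by simp
  qed
  then show "\<exists>p\<in>E d. \<forall>\<epsilon>\<in>cube d. p \<epsilon> w = y \<epsilon>" using p(1) by blast
qed

lemma dynamical_cubes_invariant:
  assumes "p \<in> E d" "y \<in> dynamical_cubes T d"
  shows "(\<lambda>\<epsilon>. p \<epsilon> (y \<epsilon>)) \<in> dynamical_cubes T d"
proof -
  obtain q where q: "q \<in> E d" "\<And>\<epsilon>. \<epsilon> \<in> cube d \<Longrightarrow> q \<epsilon> undefined = y \<epsilon>"
    using assms(2) dynamical_cubes_iff_ellis [of y d undefined] by blast
  show ?thesis
    unfolding dynamical_cubes_iff_ellis [of _ d undefined]
    using E_mult [OF assms(1) q(1)] q(2) by (intro bexI [of _ "\<lambda>i. p i \<circ> q i"]) auto
qed

lemma dynamical_cubes_transitive: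
  assumes "x \<in> dynamical_cubes T d" "y \<in> dynamical_cubes T d"
  obtains p where "p \<in> E d" "\<And>\<epsilon>. \<epsilon> \<in> cube d \<Longrightarrow> p \<epsilon> (x \<epsilon>) = y \<epsilon>"
proof -
  obtain q where q: "q \<in> E d" "\<And>\<epsilon>. \<epsilon> \<in> cube d \<Longrightarrow> q \<epsilon> undefined = x \<epsilon>"
    using assms(1) dynamical_cubes_iff_ellis [of x d undefined] by blast
  obtain r where r: "r \<in> E d" "\<And>\<epsilon>. \<epsilon> \<in> cube d \<Longrightarrow> r \<epsilon> undefined = y \<epsilon>"
    using assms(2) dynamical_cubes_iff_ellis [of y d undefined] by blast
  obtain q' where q': "q' \<in> E d" "\<And>i v. q' i (q i v) = v" "\<And>i v. q i (q' i v) = v"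
    by (rule E_inverse [OF q(1)]) (rule that)
  show ?thesis
  proof
    show "(\<lambda>i. r i \<circ> q' i) \<in> E d" using r(1) q'(1) by (rule E_mult)
    show "(r \<epsilon> \<circ> q' \<epsilon>) (x \<epsilon>) = y \<epsilon>" if "\<epsilon> \<in> cube d" for \<epsilon>
      using q(2) [OF that] r(2) [OF that] q'(2) [of \<epsilon> undefined] by simp
  qed
qed

text \<open>
  Let \<open>c\<close> be the common face, extended to a cube that does not depend on the coordinate \<open>j\<close>. By
  transitivity some \<open>p\<close> in the group fixes \<open>c\<close> on the lower face and takes it to the lower face of
  \<open>x\<close> on the upper face. Exchanging the two faces of \<open>p\<close> and multiplying by the inverse of the part that fixes
  \<open>c\<close> gives an element of the group that is the identity on the upper face and takes \<open>c\<close>, which is the lower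
  face of \<open>y\<close>, to the lower face of \<open>x\<close>. It takes \<open>y\<close> to the glued cube.
\<close>

lemma glue_faces:
  assumes j: "j \<in> {1..d}" and x: "x \<in> dynamical_cubes T d" and y: "y \<in> dynamical_cubes T d"
    and common: "\<And>\<epsilon>. \<epsilon> \<in> cube d \<Longrightarrow> x (\<epsilon>(j := 1)) = y (\<epsilon>(j := 0))"
  shows "(\<lambda>\<epsilon>. if \<epsilon> j = 0 then x \<epsilon> else y \<epsilon>) \<in> dynamical_cubes T d"
proof -
  let ?low = "\<lambda>\<epsilon> :: nat \<Rightarrow> int. \<epsilon>(j := 0)" and ?up = "\<lambda>\<epsilon> :: nat \<Rightarrow> int. \<epsilon>(j := 1)"
    and ?flip = "\<lambda>\<epsilon> :: nat \<Rightarrow> int. \<epsilon>(j := 1 - \<epsilon> j)"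
  note maps = affine_cube_map_upd [OF j] affine_cube_map_flip [OF j]
  have flip_x: "(\<lambda>\<epsilon>. x (?flip \<epsilon>)) \<in> dynamical_cubes T d"
    by (rule dynamical_cubes_comp [OF maps(2) x])
  have up_x: "(\<lambda>\<epsilon>. x (?up \<epsilon>)) \<in> dynamical_cubes T d"
    by (rule dynamical_cubes_comp [OF maps(1) x]) simp
  obtain p where p: "p \<in> E d" "\<And>\<epsilon>. \<epsilon> \<in> cube d \<Longrightarrow> p \<epsilon> (x (?up \<epsilon>)) = x (?flip \<epsilon>)"
    by (rule dynamical_cubes_transitive [OF up_x flip_x]) (rule that)
  have p_low: "p \<circ> ?low \<in> E d" using maps p(1) by (intro E_comp) auto
  obtain p' where p': "p' \<in> E d" "\<And>\<epsilon> v. p' \<epsilon> (p (?low \<epsilon>) v) = v" "\<And>\<epsilon> v. p (?low \<epsilon>) (p' \<epsilon> v) = v"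
    by (rule E_inverse [OF p_low, unfolded comp_apply]) (rule that)
  have q: "(\<lambda>\<epsilon>. (p \<circ> ?flip) \<epsilon> \<circ> p' \<epsilon>) \<in> E d"
    using maps p(1) p'(1) by (intro E_mult E_comp) auto
  have "(\<lambda>\<epsilon>. ((p \<circ> ?flip) \<epsilon> \<circ> p' \<epsilon>) (y \<epsilon>)) \<in> dynamical_cubes T d"
    by (rule dynamical_cubes_invariant [OF q y])
  then show ?thesis
  proof (rule dynamical_cubes_cong)
    fix \<epsilon> assume \<epsilon>: "\<epsilon> \<in> cube d"
    show "((p \<circ> ?flip) \<epsilon> \<circ> p' \<epsilon>) (y \<epsilon>) = (if \<epsilon> j = 0 then x \<epsilon> else y \<epsilon>)"
    proof (cases "\<epsilon> j = 0")
      case True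
      then have low: "?low \<epsilon> = \<epsilon>" by auto
      have "p (?low \<epsilon>) (y \<epsilon>) = y \<epsilon>"
        using p(2) [OF \<epsilon>] common [OF \<epsilon>] True low by simp
      then have "p' \<epsilon> (y \<epsilon>) = y \<epsilon>" using p'(2) [of \<epsilon> "y \<epsilon>"] by simp
      moreover have "p (?up \<epsilon>) (y \<epsilon>) = x \<epsilon>"
        using p(2) [of "?up \<epsilon>"] cube_upd [OF \<epsilon> j] common [OF \<epsilon>] low by simp
      ultimately show ?thesis using True by simp
    next
      case False
      then have "\<epsilon> j = 1" using cubeD [OF \<epsilon> j] by simp
      then show ?thesis using p'(3) [of \<epsilon> "y \<epsilon>"] by simp
    qed
  qed
qed

text \<open>
  Let \<open>g'\<close> be the cube both of whose faces are the lower face of \<open>g\<close>. If the base vertex of \<open>g\<close> has been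
  replaced, gluing with the reflection of \<open>g\<close> gives \<open>g'\<close> with the base vertex replaced. Conversely,
  the latter can be glued with \<open>g\<close>, since its upper face is the lower face of \<open>g\<close>.
\<close>

lemma replace_base_low:
  assumes j: "j \<in> {1..d}" and g: "g \<in> dynamical_cubes T d"
  shows "g(cube_zero d := v) \<in> dynamical_cubes T d \<longleftrightarrow>
         (\<lambda>\<epsilon>. g (\<epsilon>(j := 0)))(cube_zero d := v) \<in> dynamical_cubes T d"
proof
  note maps = affine_cube_map_upd [OF j] affine_cube_map_flip [OF j]
  have nz: "\<epsilon>(j := 1) \<noteq> cube_zero d" for \<epsilon>
  proof
    assume "\<epsilon>(j := 1) = cube_zero d"
    then have "(\<epsilon>(j := 1)) j = cube_zero d j" by simp
    then show False using j by (simp add: cube_zero_def)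
  qed
  have low: "\<epsilon>(j := 0) = \<epsilon>" if "\<epsilon> j = 0" for \<epsilon> :: "nat \<Rightarrow> int" using that by auto
  have nz': "\<epsilon> \<noteq> cube_zero d" if "\<epsilon> j \<noteq> 0" for \<epsilon> using that j by (auto simp: cube_zero_def)
  {
    assume a: "g(cube_zero d := v) \<in> dynamical_cubes T d"
    have "(\<lambda>\<epsilon>. g (\<epsilon>(j := 1 - \<epsilon> j))) \<in> dynamical_cubes T d"
      using maps(2) g by (rule dynamical_cubes_comp)
    then have "(\<lambda>\<epsilon>. if \<epsilon> j = 0 then (g(cube_zero d := v)) \<epsilon> else g (\<epsilon>(j := 1 - \<epsilon> j))) \<in> dynamical_cubes T d"
      by (intro glue_faces j a) (simp_all add: nz)
    then show "(\<lambda>\<epsilon>. g (\<epsilon>(j := 0)))(cube_zero d := v) \<in> dynamical_cubes T d"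
    proof (rule dynamical_cubes_cong)
      fix \<epsilon> assume \<epsilon>: "\<epsilon> \<in> cube d"
      show "(if \<epsilon> j = 0 then (g(cube_zero d := v)) \<epsilon> else g (\<epsilon>(j := 1 - \<epsilon> j))) =
            ((\<lambda>\<epsilon>. g (\<epsilon>(j := 0)))(cube_zero d := v)) \<epsilon>"
        using cubeD [OF \<epsilon> j] low [of \<epsilon>] nz' [of \<epsilon>] by auto
    qed
  next
    assume a: "(\<lambda>\<epsilon>. g (\<epsilon>(j := 0)))(cube_zero d := v) \<in> dynamical_cubes T d"
    have "(\<lambda>\<epsilon>. if \<epsilon> j = 0 then ((\<lambda>\<epsilon>. g (\<epsilon>(j := 0)))(cube_zero d := v)) \<epsilon> else g \<epsilon>) \<in> dynamical_cubes T d"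
      by (intro glue_faces j a g) (simp add: nz)
    then show "g(cube_zero d := v) \<in> dynamical_cubes T d"
    proof (rule dynamical_cubes_cong)
      fix \<epsilon>
      show "(if \<epsilon> j = 0 then ((\<lambda>\<epsilon>. g (\<epsilon>(j := 0)))(cube_zero d := v)) \<epsilon> else g \<epsilon>) = (g(cube_zero d := v)) \<epsilon>"
        using low [of \<epsilon>] nz' [of \<epsilon>] by auto
    qed
  }
qed

text \<open>
  Collapsing the coordinates one after the other leads from \<open>g\<close> to the constant cube at its base vertex.
\<close>

proposition replace_base_iff_const:
  assumes g: "g \<in> dynamical_cubes T d"
  shows "g(cube_zero d := v) \<in> dynamical_cubes T d \<longleftrightarrow>
         (\<lambda>_. g (cube_zero d))(cube_zero d := v) \<in> dynamical_cubes T d"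
proof -
  \<comment> \<open>\<open>\<sigma> k\<close> sets the first \<open>k\<close> coordinates to \<open>0\<close>.\<close>
  define \<sigma> where "\<sigma> k \<epsilon> = (\<lambda>i. if i \<in> {1..k} then 0 else \<epsilon> i)" for k :: nat and \<epsilon> :: "nat \<Rightarrow> int"
  have collapse: "(\<lambda>\<epsilon>. g (\<sigma> k \<epsilon>)) \<in> dynamical_cubes T d \<and>
      (g(cube_zero d := v) \<in> dynamical_cubes T d \<longleftrightarrow>
       (\<lambda>\<epsilon>. g (\<sigma> k \<epsilon>))(cube_zero d := v) \<in> dynamical_cubes T d)" if "k \<le> d" for k
    using that
  proof (induction k)
    case 0
    then show ?case using g by (simp add: \<sigma>_def)
  next
    case (Suc k)
    have \<sigma>: "\<sigma> k (\<epsilon>(Suc k := 0)) = \<sigma> (Suc k) \<epsilon>" for \<epsilon> by (auto simp: \<sigma>_def fun_eq_iff)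
    have k: "Suc k \<in> {1..d}" using Suc.prems by simp
    note IH = Suc.IH [OF Suc_leD [OF Suc.prems], THEN conjunct1] Suc.IH [OF Suc_leD [OF Suc.prems], THEN conjunct2]
    have "(\<lambda>\<epsilon>. g (\<sigma> (Suc k) \<epsilon>)) \<in> dynamical_cubes T d"
      using dynamical_cubes_comp [OF affine_cube_map_upd [OF k] IH(1), of 0] unfolding \<sigma> by simp
    then show ?case
      using replace_base_low [OF k IH(1), of v] IH(2) by (simp only: \<sigma>)
  qed
  have \<sigma>_d: "\<sigma> d \<epsilon> = cube_zero d" if "\<epsilon> \<in> cube d" for \<epsilon>
    using that by (auto simp: \<sigma>_def cube_zero_def fun_eq_iff cube_def PiE_iff extensional_def)
  have "(\<lambda>\<epsilon>. g (\<sigma> d \<epsilon>))(cube_zero d := v) \<in> dynamical_cubes T d \<longleftrightarrow>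
        (\<lambda>_. g (cube_zero d))(cube_zero d := v) \<in> dynamical_cubes T d"
    by (auto elim!: dynamical_cubes_cong simp: \<sigma>_d)
  with collapse [OF order_refl, THEN conjunct2] show ?thesis by (rule trans)
qed

end


section \<open>The regionally proximal relation of a minimal distal system\<close>

lemma closed_dynamical_cubes:
  fixes T :: "'a::metric_space \<Rightarrow> 'a"
  shows "closed (dynamical_cubes T d)"
proof -
  have "y \<in> dynamical_cubes T d" if y: "y \<in> closure (dynamical_cubes T d)" for y
  proof (rule dynamical_cubesI)
    fix \<delta> :: real assume "0 < \<delta>"
    define W where "W = (\<Inter>\<epsilon>\<in>cube d. {f :: (nat \<Rightarrow> int) \<Rightarrow> 'a. dist (f \<epsilon>) (y \<epsilon>) < \<delta> / 2})"
    have "open {f :: (nat \<Rightarrow> int) \<Rightarrow> 'a. dist (f \<epsilon>) (y \<epsilon>) < \<delta> / 2}" for \<epsilon>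
      by (intro open_Collect_less continuous_on_dist continuous_on_product_coordinates continuous_on_const)
    then have "open W" unfolding W_def by (intro open_INT) auto
    moreover have "y \<in> W" using \<open>0 < \<delta>\<close> by (simp add: W_def)
    ultimately have "W \<inter> dynamical_cubes T d \<noteq> {}"
      using y open_Int_closure_eq_empty [of W] by blast
    then obtain f where f: "f \<in> W" "f \<in> dynamical_cubes T d" by blast
    obtain w n where w: "\<And>\<epsilon>. \<epsilon> \<in> cube d \<Longrightarrow> dist (int_iter T (cube_dot d n \<epsilon>) w) (f \<epsilon>) < \<delta> / 2"
      using dynamical_cubesE [OF f(2), of "\<delta> / 2"] \<open>0 < \<delta>\<close> by (metis half_gt_zero)
    have "dist (int_iter T (cube_dot d n \<epsilon>) w) (y \<epsilon>) < \<delta>" if "\<epsilon> \<in> cube d" for \<epsilon>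
    proof -
      have "dist (f \<epsilon>) (y \<epsilon>) < \<delta> / 2" using f(1) that by (simp add: W_def)
      then show ?thesis
        using w [OF that] dist_triangle [of "int_iter T (cube_dot d n \<epsilon>) w" "y \<epsilon>" "f \<epsilon>"] by simp
    qed
    then show "\<exists>w n. \<forall>\<epsilon>\<in>cube d. dist (int_iter T (cube_dot d n \<epsilon>) w) (y \<epsilon>) < \<delta>" by blast
  qed
  then show ?thesis by (metis closure_subset_eq subsetI)
qed

lemma RP_D:
  assumes "(x, y) \<in> RP k T" "0 < \<delta>"
  shows "\<exists>x' y' n. dist x x' < \<delta> \<and> dist y y' < \<delta> \<and>
     (\<forall>\<epsilon>\<in>cube_star k.
        dist (int_iter T (cube_dot k n \<epsilon>) x') (int_iter T (cube_dot k n \<epsilon>) y') < \<delta>)"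
  using assms by (simp add: RP_def)

lemma cube_Suc_low:
  assumes "\<epsilon> \<in> cube k"
  shows "\<epsilon>(Suc k := 0) \<in> cube (Suc k)" "\<epsilon>(Suc k := 1) \<in> cube (Suc k)"
    "cube_dot (Suc k) n (\<epsilon>(Suc k := c)) = cube_dot k n \<epsilon> + c * n (Suc k)"
    "\<epsilon> = restrict (\<epsilon>(Suc k := c)) {1..k}"
  using assms by (auto simp: cube_def cube_dot_def PiE_iff extensional_def fun_eq_iff intro!: sum.cong)

lemma cube_Suc_cases:
  assumes "\<epsilon> \<in> cube (Suc k)"
  obtains \<epsilon>' where "\<epsilon>' \<in> cube k" "\<epsilon> = \<epsilon>'(Suc k := 0)" | \<epsilon>' where "\<epsilon>' \<in> cube k" "\<epsilon> = \<epsilon>'(Suc k := 1)"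
proof -
  have r: "restrict \<epsilon> {1..k} \<in> cube k" using assms by (auto simp: cube_def PiE_iff)
  have "\<epsilon> = (restrict \<epsilon> {1..k})(Suc k := \<epsilon> (Suc k))"
    using assms by (auto simp: cube_def PiE_iff extensional_def fun_eq_iff)
  moreover have "\<epsilon> (Suc k) = 0 \<or> \<epsilon> (Suc k) = 1" using cubeD [OF assms, of "Suc k"] by simp
  ultimately show ?thesis using that(1) [OF r] that(2) [OF r] by metis
qed

lemma cube_zero_Suc: "cube_zero (Suc k) = (cube_zero k)(Suc k := 0)"
  by (auto simp: cube_zero_def fun_eq_iff)

lemma cube_Suc_eq_zero_iff:
  assumes "\<epsilon> \<in> cube k"
  shows "\<epsilon>(Suc k := c) = cube_zero (Suc k) \<longleftrightarrow> c = 0 \<and> \<epsilon> = cube_zero k"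
proof
  assume eq: "\<epsilon>(Suc k := c) = cube_zero (Suc k)"
  have "(\<epsilon>(Suc k := c)) (Suc k) = cube_zero (Suc k) (Suc k)" by (simp only: eq)
  then have "c = 0" by (simp add: cube_zero_def)
  moreover have "\<epsilon> = cube_zero k"
    using cube_Suc_low(4) [OF assms, of c] cube_Suc_low(4) [OF cube_zero_in_cube [of k], of 0] eq
    by (simp add: cube_zero_Suc)
  ultimately show "c = 0 \<and> \<epsilon> = cube_zero k" by simp
qed (simp add: cube_zero_Suc)

context minimal_distal_system
begin

text \<open>
  By definition of \<open>RP\<close> there are cubes of dimension \<open>k\<close> based at points near \<open>x\<close> and \<open>y\<close>, with the same step \<open>n\<close>,
  that nearly agree at all other vertices. By minimality an iterate \<open>T\<^sup>m\<close> takes the first base point as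
  close to the second as desired, so that both are nearly opposite faces of one cube of dimension
  \<open>k + 1\<close> with last step \<open>m\<close>. A limit of these cubes has base vertex \<open>x\<close>, opposite vertex \<open>y\<close>, and
  otherwise equal faces; \<open>g\<close> is the cube that has its upper face on both sides.
\<close>

lemma RP_imp_cube:
  assumes "(x, y) \<in> RP k T"
  obtains g where "g \<in> dynamical_cubes T (Suc k)" "g (cube_zero (Suc k)) = y"
    "g(cube_zero (Suc k) := x) \<in> dynamical_cubes T (Suc k)"
proof -
  let ?Q = "dynamical_cubes T (Suc k)" and ?z = "cube_zero k"
  \<comment> \<open>The functions with the required properties up to an error \<open>\<delta>\<close>.\<close>
  define L where "L = (\<lambda>\<delta>. {f :: (nat \<Rightarrow> int) \<Rightarrow> 'a. dist (f (?z(Suc k := 0))) x \<le> \<delta> \<and> dist (f (?z(Suc k := 1))) y \<le> \<delta> \<and>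
    (\<forall>\<epsilon>\<in>cube_star k. dist (f (\<epsilon>(Suc k := 0))) (f (\<epsilon>(Suc k := 1))) \<le> \<delta>)})"
  have "?Q \<inter> (\<Inter>\<delta>\<in>{0<..}. L \<delta>) \<noteq> {}"
  proof (rule compact_imp_fip_image)
    show "compact ?Q"
      using compact_UNIV_fun [OF compact_UNIV] closed_dynamical_cubes
      by (metis closed_Int_compact inf_top.right_neutral)
    fix \<delta> :: real
    have cl: "closed {f :: (nat \<Rightarrow> int) \<Rightarrow> 'a. dist (f \<epsilon>) c \<le> \<delta>}"
      "closed {f :: (nat \<Rightarrow> int) \<Rightarrow> 'a. dist (f \<epsilon>) (f \<epsilon>') \<le> \<delta>}" for \<epsilon> \<epsilon>' c
      by (intro closed_Collect_le continuous_on_dist continuous_on_product_coordinates continuous_on_const)+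
    have "L \<delta> = {f. dist (f (?z(Suc k := 0))) x \<le> \<delta>} \<inter> {f. dist (f (?z(Suc k := 1))) y \<le> \<delta>} \<inter>
      (\<Inter>\<epsilon>\<in>cube_star k. {f. dist (f (\<epsilon>(Suc k := 0))) (f (\<epsilon>(Suc k := 1))) \<le> \<delta>})"
      unfolding L_def by blast
    then show "closed (L \<delta>)" using cl by (simp add: closed_Int closed_INT)
  next
    fix I :: "real set" assume I: "finite I" "I \<subseteq> {0<..}"
    define \<delta> where "\<delta> = Min (insert 1 I)"
    have "0 < \<delta>" unfolding \<delta>_def using I by (subst Min_gr_iff) auto
    have \<delta>: "\<delta> \<le> \<delta>'" if "\<delta>' \<in> I" for \<delta>' unfolding \<delta>_def using that I(1) by (intro Min_le) auto
    obtain x' y' n where n: "dist x x' < \<delta> / 2" "dist y y' < \<delta> / 2"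
      "\<And>\<epsilon>. \<epsilon> \<in> cube_star k \<Longrightarrow> dist (int_iter T (cube_dot k n \<epsilon>) x') (int_iter T (cube_dot k n \<epsilon>) y') < \<delta> / 2"
      using RP_D [OF assms half_gt_zero [OF \<open>0 < \<delta>\<close>]] by blast
    obtain r where r: "0 < r"
      "\<And>u v \<epsilon>. \<epsilon> \<in> cube k \<Longrightarrow> dist u v < r \<Longrightarrow> dist (int_iter T (cube_dot k n \<epsilon>) u) (int_iter T (cube_dot k n \<epsilon>) v) < \<delta> / 2"
      using uniformly_int_iter [of "cube_dot k n ` cube k" "\<delta> / 2"] \<open>0 < \<delta>\<close> finite_cube
      by (metis finite_imageI half_gt_zero imageI)
    have "y' \<in> closure (range (\<lambda>n. int_iter T n x'))" using minimal by (simp add: minimal_system_def)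
    then obtain m where m: "dist (int_iter T m x') y' < r"
      using \<open>0 < r\<close> by (auto simp: closure_approachable)
    have near: "dist (int_iter T (cube_dot k n \<epsilon>) (int_iter T m x')) (int_iter T (cube_dot k n \<epsilon>) y') < \<delta> / 2"
      if "\<epsilon> \<in> cube k" for \<epsilon>
      using r(2) [OF that m] .
    define f where "f = (\<lambda>\<epsilon>. int_iter T (cube_dot (Suc k) (n(Suc k := m)) \<epsilon>) x')"
    have dot: "cube_dot k (n(Suc k := m)) \<epsilon> = cube_dot k n \<epsilon>" for \<epsilon>
      unfolding cube_dot_def by (intro sum.cong) auto
    have f0: "f (\<epsilon>(Suc k := 0)) = int_iter T (cube_dot k n \<epsilon>) x'" if "\<epsilon> \<in> cube k" for \<epsilon>
      using that by (simp add: f_def cube_Suc_low(3) dot)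
    have f1: "f (\<epsilon>(Suc k := 1)) = int_iter T (cube_dot k n \<epsilon>) (int_iter T m x')" if "\<epsilon> \<in> cube k" for \<epsilon>
      using that by (simp add: f_def cube_Suc_low(3) dot int_iter_add [OF bij_T])
    have "f \<in> ?Q"
    proof (rule dynamical_cubesI)
      fix e :: real assume "0 < e"
      then have "\<forall>\<epsilon>\<in>cube (Suc k). dist (int_iter T (cube_dot (Suc k) (n(Suc k := m)) \<epsilon>) x') (f \<epsilon>) < e"
        by (simp add: f_def)
      then show "\<exists>w n. \<forall>\<epsilon>\<in>cube (Suc k). dist (int_iter T (cube_dot (Suc k) n \<epsilon>) w) (f \<epsilon>) < e" by blast
    qed
    moreover have "f \<in> L \<delta>"
      unfolding L_def mem_Collect_eq
    proof (intro conjI ballI)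
      show "dist (f (?z(Suc k := 0))) x \<le> \<delta>" using n(1) \<open>0 < \<delta>\<close> f0 [of ?z] by (simp add: dist_commute)
      show "dist (f (?z(Suc k := 1))) y \<le> \<delta>"
        using near [of ?z] n(2) f1 [of ?z] dist_triangle2 [of "int_iter T m x'" y y'] by simp
      fix \<epsilon> assume "\<epsilon> \<in> cube_star k"
      then show "dist (f (\<epsilon>(Suc k := 0))) (f (\<epsilon>(Suc k := 1))) \<le> \<delta>"
        using near [of \<epsilon>] n(3) [of \<epsilon>] f0 [of \<epsilon>] f1 [of \<epsilon>]
          dist_triangle2 [of "f (\<epsilon>(Suc k := 0))" "f (\<epsilon>(Suc k := 1))" "int_iter T (cube_dot k n \<epsilon>) y'"]
        by simp
    qed
    moreover have "L \<delta> \<subseteq> L \<delta>'" if "\<delta>' \<in> I" for \<delta>'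
      using \<delta> [OF that] unfolding L_def by (auto intro: order_trans)
    ultimately show "?Q \<inter> (\<Inter>\<delta>\<in>I. L \<delta>) \<noteq> {}" by blast
  qed
  then obtain f where f: "f \<in> ?Q" "\<And>\<delta>. 0 < \<delta> \<Longrightarrow> f \<in> L \<delta>" by auto
  have zero: "u = v" if "\<And>\<delta>. 0 < \<delta> \<Longrightarrow> dist u v \<le> \<delta>" for u v :: 'a
  proof -
    have "dist u v \<le> 0" by (rule field_le_epsilon) (simp add: that)
    then show ?thesis by simp
  qed
  have fx: "f (?z(Suc k := 0)) = x" and fy: "f (?z(Suc k := 1)) = y"
    using f(2) by (auto simp: L_def intro!: zero)
  have fe: "f (\<epsilon>(Suc k := 0)) = f (\<epsilon>(Suc k := 1))" if "\<epsilon> \<in> cube_star k" for \<epsilon>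
    using f(2) that by (intro zero) (auto simp: L_def)
  show ?thesis
  proof
    have "affine_cube_map (Suc k) (\<lambda>\<epsilon>. \<epsilon>(Suc k := 1))" by (rule affine_cube_map_upd) auto
    then show "(\<lambda>\<epsilon>. f (\<epsilon>(Suc k := 1))) \<in> ?Q" using f(1) by (rule dynamical_cubes_comp)
    show "f ((cube_zero (Suc k))(Suc k := 1)) = y" using fy by (simp add: cube_zero_Suc)
    show "(\<lambda>\<epsilon>. f (\<epsilon>(Suc k := 1)))(cube_zero (Suc k) := x) \<in> ?Q"
    proof (rule dynamical_cubes_cong [OF f(1)])
      fix \<epsilon> assume "\<epsilon> \<in> cube (Suc k)"
      then show "f \<epsilon> = ((\<lambda>\<epsilon>. f (\<epsilon>(Suc k := 1)))(cube_zero (Suc k) := x)) \<epsilon>"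
      proof (cases rule: cube_Suc_cases)
        case (1 \<epsilon>')
        show ?thesis
        proof (cases "\<epsilon>' = ?z")
          case True
          then show ?thesis using 1 fx by (simp add: cube_zero_Suc)
        next
          case False
          then show ?thesis using 1 fe [of \<epsilon>'] by (simp add: cube_Suc_eq_zero_iff)
        qed
      next
        case (2 \<epsilon>')
        then show ?thesis by (simp add: cube_Suc_eq_zero_iff)
      qed
    qed
  qed
qed

lemma cube_imp_RP:
  assumes "(\<lambda>_. y)(cube_zero (Suc k) := x) \<in> dynamical_cubes T (Suc k)"
  shows "(x, y) \<in> RP k T"
proof -
  have "\<exists>x' y' n. dist x x' < \<delta> \<and> dist y y' < \<delta> \<and>
      (\<forall>\<epsilon>\<in>cube_star k. dist (int_iter T (cube_dot k n \<epsilon>) x') (int_iter T (cube_dot k n \<epsilon>) y') < \<delta>)"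
    if \<delta>: "0 < \<delta>" for \<delta>
  proof -
    obtain w n where w: "\<And>\<epsilon>. \<epsilon> \<in> cube (Suc k) \<Longrightarrow>
        dist (int_iter T (cube_dot (Suc k) n \<epsilon>) w) (((\<lambda>_. y)(cube_zero (Suc k) := x)) \<epsilon>) < \<delta> / 2"
      using dynamical_cubesE [OF assms half_gt_zero [OF \<delta>]] by blast
    let ?w' = "int_iter T (n (Suc k)) w"
    have low: "dist (int_iter T (cube_dot k n \<epsilon>) w) (if \<epsilon> = cube_zero k then x else y) < \<delta> / 2"
      if "\<epsilon> \<in> cube k" for \<epsilon>
      using w [OF cube_Suc_low(1) [OF that]] cube_Suc_eq_zero_iff [OF that, of 0] that
      by (simp add: cube_Suc_low(3))
    have high: "dist (int_iter T (cube_dot k n \<epsilon>) ?w') y < \<delta> / 2" if "\<epsilon> \<in> cube k" for \<epsilon>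
      using w [OF cube_Suc_low(2) [OF that]] cube_Suc_eq_zero_iff [OF that, of 1] that
      by (simp add: cube_Suc_low(3) int_iter_add [OF bij_T])
    have "dist x w < \<delta>" "dist y ?w' < \<delta>"
      using low [of "cube_zero k"] high [of "cube_zero k"] \<open>0 < \<delta>\<close> by (simp_all add: dist_commute)
    moreover have "dist (int_iter T (cube_dot k n \<epsilon>) w) (int_iter T (cube_dot k n \<epsilon>) ?w') < \<delta>"
      if "\<epsilon> \<in> cube_star k" for \<epsilon>
      using low [of \<epsilon>] high [of \<epsilon>] that dist_triangle_half_l [of _ y \<delta>] by auto
    ultimately show ?thesis by blast
  qed
  then show ?thesis by (simp add: RP_def)
qed

text \<open>
  The cube that \<open>RP_imp_cube\<close> provides and \<open>h\<close> have the same base vertex, and only the base vertex decides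
  whether a replacement is possible.
\<close>

lemma replace_base:
  assumes "(x, y) \<in> RP k T" "h \<in> dynamical_cubes T (Suc k)" "h (cube_zero (Suc k)) = y"
  shows "h(cube_zero (Suc k) := x) \<in> dynamical_cubes T (Suc k)"
proof -
  obtain g where g: "g \<in> dynamical_cubes T (Suc k)" "g (cube_zero (Suc k)) = y"
    "g(cube_zero (Suc k) := x) \<in> dynamical_cubes T (Suc k)"
    by (rule RP_imp_cube [OF assms(1)]) (rule that)
  show ?thesis
    using replace_base_iff_const [OF g(1), of x] replace_base_iff_const [OF assms(2), of x] g assms(3)
    by simp
qed

text \<open>
  In this form the relation is visibly closed and invariant.
\<close>

proposition RP_iff_cube:
  "(x, y) \<in> RP k T \<longleftrightarrow> (\<lambda>_. y)(cube_zero (Suc k) := x) \<in> dynamical_cubes T (Suc k)"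
  using replace_base [OF _ const_in_dynamical_cubes, of x y k y] cube_imp_RP by blast

lemma equiv_RP: "equiv UNIV (RP k T)"
proof (rule equivI)
  show "RP k T \<subseteq> UNIV \<times> UNIV" by simp
  show "refl (RP k T)"
  proof (rule refl_onI)
    fix x :: 'a
    have "(\<lambda>_. x)(cube_zero (Suc k) := x) = (\<lambda>_. x)" by auto
    then show "(x, x) \<in> RP k T" by (simp only: RP_iff_cube const_in_dynamical_cubes)
  qed
  show "sym (RP k T)"
  proof (rule symI)
    fix x y assume "(x, y) \<in> RP k T"
    have "\<exists>x' y' n. dist y x' < \<delta> \<and> dist x y' < \<delta> \<and>
        (\<forall>\<epsilon>\<in>cube_star k. dist (int_iter T (cube_dot k n \<epsilon>) x') (int_iter T (cube_dot k n \<epsilon>) y') < \<delta>)"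
      if \<delta>: "0 < \<delta>" for \<delta>
    proof -
      obtain x' y' n where "dist x x' < \<delta>" "dist y y' < \<delta>"
        "\<forall>\<epsilon>\<in>cube_star k. dist (int_iter T (cube_dot k n \<epsilon>) x') (int_iter T (cube_dot k n \<epsilon>) y') < \<delta>"
        using RP_D [OF \<open>(x, y) \<in> RP k T\<close> \<delta>] by blast
      then show ?thesis
        by (intro exI [of _ y'] exI [of _ x'] exI [of _ n]) (simp add: dist_commute)
    qed
    then show "(y, x) \<in> RP k T" by (simp add: RP_def)
  qed
  show "trans (RP k T)"
  proof (rule transI)
    fix x y z assume xy: "(x, y) \<in> RP k T" and yz: "(y, z) \<in> RP k T"
    have "((\<lambda>_. z)(cube_zero (Suc k) := y))(cube_zero (Suc k) := x) \<in> dynamical_cubes T (Suc k)"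
    proof (rule replace_base [OF xy])
      show "(\<lambda>_. z)(cube_zero (Suc k) := y) \<in> dynamical_cubes T (Suc k)"
        using yz by (simp only: RP_iff_cube)
    qed simp
    then show "(x, z) \<in> RP k T" by (simp only: RP_iff_cube fun_upd_upd)
  qed
qed

lemma closed_RP: "closed (RP k T)"
proof -
  have "continuous_on UNIV (\<lambda>p :: 'a \<times> 'a. (\<lambda>\<epsilon>. if \<epsilon> = cube_zero (Suc k) then fst p else snd p))"
  proof (rule continuous_on_coordinatewise_then_product)
    fix \<epsilon> show "continuous_on UNIV (\<lambda>p :: 'a \<times> 'a. if \<epsilon> = cube_zero (Suc k) then fst p else snd p)"
      by (cases "\<epsilon> = cube_zero (Suc k)") (auto intro: continuous_intros)
  qed
  then have "closed ((\<lambda>p :: 'a \<times> 'a. (\<lambda>\<epsilon>. if \<epsilon> = cube_zero (Suc k) then fst p else snd p)) -` dynamical_cubes T (Suc k))"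
    using closed_dynamical_cubes by (intro closed_vimage) auto
  moreover have "RP k T = (\<lambda>p. (\<lambda>\<epsilon>. if \<epsilon> = cube_zero (Suc k) then fst p else snd p)) -` dynamical_cubes T (Suc k)"
  proof (rule Set.set_eqI)
    fix p show "p \<in> RP k T \<longleftrightarrow>
        p \<in> (\<lambda>p. (\<lambda>\<epsilon>. if \<epsilon> = cube_zero (Suc k) then fst p else snd p)) -` dynamical_cubes T (Suc k)"
      by (cases p) (simp only: RP_iff_cube fun_upd_def fst_conv snd_conv vimage_eq)
  qed
  ultimately show ?thesis by simp
qed

lemma RP_int_iter:
  assumes "(x, y) \<in> RP k T"
  shows "(int_iter T m x, int_iter T m y) \<in> RP k T"
proof -
  have "(\<lambda>\<epsilon>. int_iter T m (((\<lambda>_. y)(cube_zero (Suc k) := x)) \<epsilon>)) \<in> dynamical_cubes T (Suc k)"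
    using assms int_iter_in_ellis [OF const_in_affine_cube_functions]
    by (intro dynamical_cubes_invariant [of "\<lambda>_. int_iter T m"]) (simp_all only: RP_iff_cube)
  moreover have "(\<lambda>\<epsilon>. int_iter T m (((\<lambda>_. y)(cube_zero (Suc k) := x)) \<epsilon>)) =
      (\<lambda>_. int_iter T m y)(cube_zero (Suc k) := int_iter T m x)"
    by auto
  ultimately show ?thesis by (simp only: RP_iff_cube)
qed

text \<open>
  The reflection \<open>\<rho>\<close> moves the vertex \<open>c\<close> to the base and back.
\<close>

lemma replace_vertex:
  assumes "(v, h c) \<in> RP k T" "h \<in> dynamical_cubes T (Suc k)" "c \<in> cube (Suc k)"
  shows "h(c := v) \<in> dynamical_cubes T (Suc k)"
proof -
  define \<rho> where "\<rho> = (\<lambda>\<epsilon>. \<lambda>i\<in>{1..Suc k}. c i + (1 - 2 * c i) * \<epsilon> i)"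
  have \<rho>: "affine_cube_map (Suc k) \<rho>" unfolding \<rho>_def by (rule affine_cube_map_reflect [OF assms(3)])
  have \<rho>_\<rho>: "\<rho> (\<rho> \<epsilon>) = \<epsilon>" if "\<epsilon> \<in> cube (Suc k)" for \<epsilon>
  proof
    fix i show "\<rho> (\<rho> \<epsilon>) i = \<epsilon> i"
    proof (cases "i \<in> {1..Suc k}")
      case True
      then show ?thesis using cubeD [OF assms(3) True] by (auto simp: \<rho>_def)
    next
      case False
      then show ?thesis using that unfolding \<rho>_def cube_def by (auto simp: PiE_iff extensional_def)
    qed
  qed
  have \<rho>_c: "\<rho> (cube_zero (Suc k)) = c"
  proof
    fix i show "\<rho> (cube_zero (Suc k)) i = c i"
    proof (cases "i \<in> {1..Suc k}")
      case True
      then show ?thesis by (simp add: \<rho>_def cube_zero_def)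
    next
      case False
      then show ?thesis using assms(3) unfolding \<rho>_def cube_def by (auto simp: PiE_iff extensional_def)
    qed
  qed
  have "(\<lambda>\<epsilon>. h (\<rho> \<epsilon>))(cube_zero (Suc k) := v) \<in> dynamical_cubes T (Suc k)"
    by (rule replace_base [OF assms(1) dynamical_cubes_comp [OF \<rho> assms(2)]]) (simp add: \<rho>_c)
  then have "(\<lambda>\<epsilon>. ((\<lambda>\<epsilon>. h (\<rho> \<epsilon>))(cube_zero (Suc k) := v)) (\<rho> \<epsilon>)) \<in> dynamical_cubes T (Suc k)"
    by (rule dynamical_cubes_comp [OF \<rho>])
  then show ?thesis
  proof (rule dynamical_cubes_cong)
    fix \<epsilon> assume \<epsilon>: "\<epsilon> \<in> cube (Suc k)"
    have "\<rho> \<epsilon> = cube_zero (Suc k) \<longleftrightarrow> \<epsilon> = c"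
      using \<rho>_\<rho> [OF \<epsilon>] \<rho>_\<rho> [of "cube_zero (Suc k)"] \<rho>_c by auto
    then show "((\<lambda>\<epsilon>. h (\<rho> \<epsilon>))(cube_zero (Suc k) := v)) (\<rho> \<epsilon>) = (h(c := v)) \<epsilon>"
      using \<rho>_\<rho> [OF \<epsilon>] by simp
  qed
qed

proposition dynamical_cubes_saturated:
  assumes y: "y \<in> dynamical_cubes T (Suc k)"
    and z: "\<And>\<epsilon>. \<epsilon> \<in> cube (Suc k) \<Longrightarrow> (z \<epsilon>, y \<epsilon>) \<in> RP k T"
  shows "z \<in> dynamical_cubes T (Suc k)"
proof -
  have "(\<lambda>\<epsilon>. if \<epsilon> \<in> C then z \<epsilon> else y \<epsilon>) \<in> dynamical_cubes T (Suc k)"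
    if "finite C" "C \<subseteq> cube (Suc k)" for C
    using that
  proof (induction C rule: finite_induct)
    case empty
    then show ?case using y by simp
  next
    case (insert c C)
    let ?h = "\<lambda>\<epsilon>. if \<epsilon> \<in> C then z \<epsilon> else y \<epsilon>"
    have "?h(c := z c) \<in> dynamical_cubes T (Suc k)"
      using insert z by (intro replace_vertex) auto
    moreover have "?h(c := z c) = (\<lambda>\<epsilon>. if \<epsilon> \<in> insert c C then z \<epsilon> else y \<epsilon>)" by auto
    ultimately show ?case by simp
  qed
  from this [OF finite_cube subset_refl] show ?thesis
    by (rule dynamical_cubes_cong) simp
qed

end


section \<open>Quotients of compact metric spaces\<close>

text \<open>
  For each pair \<open>(U, V)\<close> of basic open sets of \<open>X\<close> pick, if possible, a continuous function on \<open>Y\<close> that is \<open>0\<close>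
  on the image of \<open>U\<close> and \<open>1\<close> on the image of \<open>V\<close>. By Urysohn's lemma, these countably many functions
  separate the points of \<open>Y\<close>, so they embed the compact space \<open>Y\<close> into a countable power of the reals.
\<close>

lemma metrizable_space_compact_Hausdorff_image:
  assumes X: "second_countable X" and Y: "compact_space Y" "Hausdorff_space Y"
    and q: "continuous_map X Y q" "q ` topspace X = topspace Y"
  shows "metrizable_space Y"
proof -
  obtain \<B> where "countable \<B> \<and> (\<forall>V\<in>\<B>. openin X V) \<and>
      (\<forall>U x. openin X U \<and> x \<in> U \<longrightarrow> (\<exists>V\<in>\<B>. x \<in> V \<and> V \<subseteq> U))"
    using X unfolding second_countable_def by (rule exE)
  then have \<B>: "countable \<B>" "\<And>U x. openin X U \<Longrightarrow> x \<in> U \<Longrightarrow> \<exists>V\<in>\<B>. x \<in> V \<and> V \<subseteq> U"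
    by simp_all
  define good where "good = (\<lambda>p h. continuous_map Y euclideanreal h \<and>
    (\<forall>x\<in>fst p. h (q x) = 0) \<and> (\<forall>x\<in>snd p. h (q x) = 1))"
  define g where "g = (\<lambda>p. if \<exists>h. good p h then SOME h. good p h else (\<lambda>_. 0))"
  have good_g: "good p (g p)" if "good p h" for p h
    using that someI [of "good p" h] unfolding g_def by auto
  have cont_g: "continuous_map Y euclideanreal (g p)" for p
  proof (cases "\<exists>h. good p h")
    case True
    then show ?thesis using good_g good_def by blast
  next
    case False
    then have "g p = (\<lambda>_. 0)" by (simp only: g_def if_False)
    then show ?thesis by simp
  qed
  define F where "F = (\<lambda>y n. g (from_nat_into (\<B> \<times> \<B>) n) y)"
  have "continuous_map Y (product_topology (\<lambda>n::nat. euclideanreal) UNIV) F"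
    unfolding continuous_map_componentwise_UNIV F_def using cont_g by simp
  then have cont_F: "continuous_map Y euclidean F" by (simp add: euclidean_product_topology)
  have "inj_on F (topspace Y)"
  proof (rule inj_onI, rule ccontr)
    fix y z assume y: "y \<in> topspace Y" and z: "z \<in> topspace Y" and F: "F y = F z" and "y \<noteq> z"
    have "normal_space Y" using Y by (simp add: compact_Hausdorff_or_regular_imp_normal_space)
    moreover have "closedin Y {y}" "closedin Y {z}" "disjnt {y} {z}"
      using Y(2) y z \<open>y \<noteq> z\<close> by (auto simp: closedin_Hausdorff_singleton)
    ultimately obtain f where f: "continuous_map Y euclideanreal f" "f ` {y} \<subseteq> {- 1}" "f ` {z} \<subseteq> {2}"
      by (rule Urysohn_lemma_alt)
    \<comment> \<open>Truncation makes the function constant near each of the two points, because \<open>f\<close> takes values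
      outside \<open>[0, 1]\<close> there.\<close>
    define h where "h = (\<lambda>t. max 0 (min 1 t)) \<circ> f"
    have "continuous_map euclideanreal euclideanreal (\<lambda>t. max 0 (min 1 t))"
      by (simp add: continuous_intros)
    then have cont_h: "continuous_map Y euclideanreal h"
      unfolding h_def using f(1) by (rule continuous_map_compose [rotated])
    have fq: "continuous_map X euclideanreal (f \<circ> q)" using q(1) f(1) by (rule continuous_map_compose)
    obtain a b where a: "a \<in> topspace X" "q a = y" and b: "b \<in> topspace X" "q b = z"
      using y z q(2) by (metis imageE)
    have "openin X {x \<in> topspace X. (f \<circ> q) x \<in> {..<0}}" "openin X {x \<in> topspace X. (f \<circ> q) x \<in> {1<..}}"
      by (rule openin_continuous_map_preimage [OF fq], simp)+
    moreover have "a \<in> {x \<in> topspace X. (f \<circ> q) x \<in> {..<0}}" "b \<in> {x \<in> topspace X. (f \<circ> q) x \<in> {1<..}}"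
      using a b f by auto
    ultimately obtain U V where U: "U \<in> \<B>" "a \<in> U" "U \<subseteq> {x \<in> topspace X. (f \<circ> q) x \<in> {..<0}}"
      and V: "V \<in> \<B>" "b \<in> V" "V \<subseteq> {x \<in> topspace X. (f \<circ> q) x \<in> {1<..}}"
      using \<B>(2) by meson
    have "h (q x) = 0" if "x \<in> U" for x using that U(3) by (auto simp: h_def)
    moreover have "h (q x) = 1" if "x \<in> V" for x using that V(3) by (auto simp: h_def)
    ultimately have "good (U, V) h" using cont_h by (simp add: good_def)
    then have "good (U, V) (g (U, V))" by (rule good_g)
    then have "g (U, V) y = 0" "g (U, V) z = 1" using U(2) V(2) a b by (auto simp: good_def)
    moreover obtain n where "from_nat_into (\<B> \<times> \<B>) n = (U, V)"
      using from_nat_into_surj [of "\<B> \<times> \<B>" "(U, V)"] \<B>(1) U(1) V(1) by auto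
    ultimately show False using fun_cong [OF F, of n] by (simp add: F_def)
  qed
  then have "embedding_map Y (euclidean :: (nat \<Rightarrow> real) topology) F"
    using cont_F Y(1) by (intro continuous_imp_embedding_map) auto
  then have "Y homeomorphic_space subtopology euclidean (F ` topspace Y)"
    by (rule embedding_map_imp_homeomorphic_space)
  then show ?thesis
    using homeomorphic_metrizable_space metrizable_space_subtopology metrizable_space_euclidean by blast
qed

lemma topspace_quotient_topology: "topspace (quotient_topology R) = UNIV // R"
proof -
  have "openin (quotient_topology R) (UNIV // R)"
  proof -
    have "(\<lambda>x. R `` {x}) -` (UNIV // R) = UNIV" by (auto simp: quotient_def)
    then show ?thesis by (simp add: openin_quotient_topology)
  qed
  then show ?thesis
    using openin_subset openin_topspace openin_quotient_topology by (metis subset_antisym)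
qed

lemma continuous_map_quotient: "continuous_map euclidean (quotient_topology R) (\<lambda>x. R `` {x})"
  unfolding continuous_map_def
  by (auto simp: topspace_quotient_topology openin_quotient_topology quotientI vimage_def)

lemma quotient_map_image: "(\<lambda>x. R `` {x}) ` UNIV = UNIV // R"
  by (auto simp: quotient_def)

lemma continuous_map_quotient_image:
  assumes "continuous_on UNIV S" "\<And>x. S ` (R `` {x}) = R `` {S x}"
  shows "continuous_map (quotient_topology R) (quotient_topology R) (image S)"
  unfolding continuous_map_def topspace_quotient_topology
proof (intro conjI allI impI)
  show "image S \<in> UNIV // R \<rightarrow> UNIV // R"
    using assms(2) by (auto simp: quotient_def)
  fix U assume U: "openin (quotient_topology R) U"
  have "(\<lambda>x. R `` {x}) -` {C \<in> UNIV // R. S ` C \<in> U} = S -` ((\<lambda>x. R `` {x}) -` U)"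
    using assms(2) by (auto simp: quotient_def)
  moreover have "open (S -` ((\<lambda>x. R `` {x}) -` U))"
    using U assms(1) by (intro open_vimage) (auto simp: openin_quotient_topology)
  ultimately show "openin (quotient_topology R) {C \<in> UNIV // R. S ` C \<in> U}"
    by (auto simp: openin_quotient_topology)
qed

context compact_system
begin

lemma second_countable_euclidean: "second_countable (euclidean :: 'a topology)"
proof -
  obtain N :: "nat \<Rightarrow> 'a set"
    where fin: "\<And>k. finite (N k)" and net: "\<And>k x. \<exists>c\<in>N k. dist c x < inverse (real (Suc k))"
    by (rule finite_nets) (rule that)
  define \<B> where "\<B> = (\<Union>k. (\<lambda>c. ball c (inverse (real (Suc k)))) ` N k)"
  have "countable ((\<lambda>c. ball c (inverse (real (Suc k)))) ` N k)" for k
    by (intro countable_finite finite_imageI fin)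
  then have "countable \<B>" unfolding \<B>_def by (intro countable_UN) auto
  moreover have "\<forall>V\<in>\<B>. openin euclidean V" by (auto simp: \<B>_def)
  moreover have "\<exists>V\<in>\<B>. x \<in> V \<and> V \<subseteq> U" if U: "open U" "x \<in> U" for U x
  proof -
    obtain e where "0 < e" and e: "ball x e \<subseteq> U" using U open_contains_ball [of U] by blast
    obtain k where k: "inverse (real (Suc k)) < e / 2"
      using \<open>0 < e\<close> reals_Archimedean half_gt_zero by blast
    obtain c where c: "c \<in> N k" "dist c x < inverse (real (Suc k))" using net by blast
    have "ball c (inverse (real (Suc k))) \<subseteq> ball x e"
    proof
      fix y assume "y \<in> ball c (inverse (real (Suc k)))"
      then show "y \<in> ball x e"
        using c(2) k dist_triangle3 [of x y c] by simp
    qed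
    then have "ball c (inverse (real (Suc k))) \<subseteq> U" using e by blast
    moreover have "ball c (inverse (real (Suc k))) \<in> \<B>" using c(1) by (auto simp: \<B>_def)
    moreover have "x \<in> ball c (inverse (real (Suc k)))" using c(2) by simp
    ultimately show ?thesis by blast
  qed
  ultimately show ?thesis unfolding second_countable_def by (intro exI [of _ \<B>]) auto
qed

text \<open>
  The quotient map is closed because the saturation of a closed set is the projection of a compact
  set. So the quotient is Hausdorff, and metrizable as an image of a compact metric space.
\<close>

proposition factor_map_quotient:
  fixes R :: "('a \<times> 'a) set"
  assumes equiv: "equiv UNIV R" and "closed R"
    and invariant: "\<And>m x y. (x, y) \<in> R \<Longrightarrow> (int_iter T m x, int_iter T m y) \<in> R"
  shows "factor_map euclidean T (quotient_topology R) (image T) (\<lambda>x. R `` {x})"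
proof -
  let ?q = "\<lambda>x. R `` {x}" and ?Y = "quotient_topology R"
  have iter: "int_iter T m ` (R `` {x}) = R `` {int_iter T m x}" for m x
  proof
    show "int_iter T m ` (R `` {x}) \<subseteq> R `` {int_iter T m x}" using invariant by auto
    show "R `` {int_iter T m x} \<subseteq> int_iter T m ` (R `` {x})"
    proof
      fix y assume "y \<in> R `` {int_iter T m x}"
      then have "(int_iter T (- m) (int_iter T m x), int_iter T (- m) y) \<in> R" by (auto intro: invariant)
      then have "int_iter T (- m) y \<in> R `` {x}" by (simp add: bij_T)
      then show "y \<in> int_iter T m ` (R `` {x})" by (rule image_eqI [rotated]) (simp add: bij_T)
    qed
  qed
  have 1: "int_iter T 1 = T" by (simp add: fun_eq_iff)
  have compact_X: "compact_space (euclidean :: 'a topology)"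
    using system by (simp add: dynamical_system_def)
  have onto: "?q ` topspace euclidean = topspace ?Y"
    by (simp add: topspace_quotient_topology quotient_map_image)
  have "compactin ?Y (?q ` UNIV)"
    using continuous_map_quotient compact_X by (intro image_compactin) (auto simp: compact_space_def)
  then have compact_Y: "compact_space ?Y"
    using onto by (simp add: compact_space_def)
  have "closed_map euclidean ?Y ?q"
    unfolding closed_map_def
  proof (intro allI impI)
    fix C :: "'a set" assume "closedin euclidean C"
    then have "closed C" by simp
    have "- (?q -` (UNIV // R - ?q ` C)) = snd ` (R \<inter> C \<times> UNIV)"
    proof (rule Set.set_eqI)
      fix x
      have "x \<in> - (?q -` (UNIV // R - ?q ` C)) \<longleftrightarrow> (\<exists>c\<in>C. R `` {x} = R `` {c})"
        by (simp add: quotientI image_iff)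
      also have "\<dots> \<longleftrightarrow> (\<exists>c\<in>C. (c, x) \<in> R)"
        using eq_equiv_class_iff [OF equiv] by (metis UNIV_I)
      also have "\<dots> \<longleftrightarrow> x \<in> snd ` (R \<inter> C \<times> UNIV)" by force
      finally show "x \<in> - (?q -` (UNIV // R - ?q ` C)) \<longleftrightarrow> x \<in> snd ` (R \<inter> C \<times> UNIV)" .
    qed
    moreover have "compact (snd ` (R \<inter> C \<times> UNIV))"
    proof (intro compact_continuous_image continuous_on_snd continuous_on_id)
      have "compact ((UNIV :: 'a set) \<times> (UNIV :: 'a set))" using compact_UNIV compact_UNIV by (rule compact_Times)
      then show "compact (R \<inter> C \<times> UNIV)"
        using \<open>closed R\<close> \<open>closed C\<close> by (metis UNIV_Times_UNIV closed_Int closed_Int_compact closed_Times closed_UNIV inf_top.right_neutral)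
    qed
    ultimately have "open (?q -` (UNIV // R - ?q ` C))"
      using compact_imp_closed by (metis open_closed)
    then have "openin ?Y (UNIV // R - ?q ` C)" by (simp add: openin_quotient_topology)
    then show "closedin ?Y (?q ` C)"
      unfolding closedin_def topspace_quotient_topology by (auto intro: quotientI)
  qed
  moreover have "normal_space (euclidean :: 'a topology)"
    by (simp add: metrizable_imp_normal_space metrizable_space_euclidean)
  moreover have "Hausdorff_space (euclidean :: 'a topology)"
    by (simp add: metrizable_imp_Hausdorff_space metrizable_space_euclidean)
  ultimately have "Hausdorff_space ?Y"
    using normal_Hausdorff_space_closed_continuous_map_image [OF _ _ _ continuous_map_quotient onto]
    by blast
  then have "metrizable_space ?Y"
    using second_countable_euclidean compact_Y continuous_map_quotient onto
    by (intro metrizable_space_compact_Hausdorff_image)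
  moreover have "homeomorphic_map ?Y ?Y (image T)"
  proof -
    have cont: "continuous_map ?Y ?Y (image (int_iter T m))" for m
      by (rule continuous_map_quotient_image [OF continuous_int_iter iter])
    have inverse: "int_iter T (- 1) ` int_iter T 1 ` C = C" "int_iter T 1 ` int_iter T (- 1) ` C = C" for C
      by (simp_all only: image_image int_iter_minus [OF bij_T] image_ident)
    have "homeomorphic_maps ?Y ?Y (image (int_iter T 1)) (image (int_iter T (- 1)))"
      using cont inverse by (simp add: homeomorphic_maps_def del: int_iter_1)
    then show ?thesis using homeomorphic_maps_imp_map unfolding 1 by blast
  qed
  ultimately have "dynamical_system ?Y (image T)"
    using compact_Y by (simp add: dynamical_system_def)
  then show ?thesis
    using system continuous_map_quotient onto iter [of 1] by (simp add: factor_map_def 1)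
qed

end

section \<open>The characteristic factors\<close>

text \<open>
  Since \<open>cube_star 0\<close> is empty, \<open>RP 0 T\<close> relates all pairs and is the relation that defines
  \<open>Z\<^sub>0\<close>. Thus the case \<open>d = 1\<close> is an instance of the general one.
\<close>

proposition (in minimal_distal_system) pro_nilfactor_characteristic:
  assumes "1 \<le> d"
  shows "cubic_characteristic_factor d T
    (pro_nilfactor (d - 1) T) (pro_nilfactor_action T) (pro_nilfactor_map (d - 1) T)"
proof -
  obtain k where d: "d = Suc k" using assms by (cases d) auto
  have star_0: "cube_star 0 = {}" by (auto simp: cube_def cube_zero_def restrict_def)
  have "(x, y) \<in> RP 0 T" for x y
    unfolding RP_def star_0 by (auto intro: exI [of _ x] exI [of _ y])
  then have rel: "pro_nil_rel k T = RP k T" by (cases "k = 0") (auto simp: pro_nil_rel_def)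
  show ?thesis
  proof (rule cubic_characteristic_factorI)
    have "factor_map euclidean T (quotient_topology (RP k T)) (image T) (\<lambda>x. RP k T `` {x})"
      by (intro factor_map_quotient equiv_RP closed_RP RP_int_iter)
    moreover have "pro_nilfactor_map k T = (\<lambda>x. RP k T `` {x})"
      by (simp add: fun_eq_iff pro_nilfactor_map_def rel)
    ultimately show "factor_map euclidean T (pro_nilfactor (d - 1) T) (pro_nilfactor_action T) (pro_nilfactor_map (d - 1) T)"
      by (simp add: d pro_nilfactor_def pro_nilfactor_action_def rel)
  next
    fix y z :: "(nat \<Rightarrow> int) \<Rightarrow> 'a"
    assume y: "y \<in> dynamical_cubes T d" and base: "z (cube_zero d) = y (cube_zero d)"
      and eq: "\<And>\<epsilon>. \<epsilon> \<in> cube_star d \<Longrightarrow> pro_nilfactor_map (d - 1) T (z \<epsilon>) = pro_nilfactor_map (d - 1) T (y \<epsilon>)"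
    have "(z \<epsilon>, y \<epsilon>) \<in> RP k T" if "\<epsilon> \<in> cube d" for \<epsilon>
    proof -
      have "RP k T `` {z \<epsilon>} = RP k T `` {y \<epsilon>}"
        using base eq [of \<epsilon>] that by (cases "\<epsilon> = cube_zero d") (simp_all add: pro_nilfactor_map_def d rel)
      then show ?thesis using eq_equiv_class_iff [OF equiv_RP, of "z \<epsilon>" "y \<epsilon>" k] by simp
    qed
    then show "z \<in> dynamical_cubes T d" using dynamical_cubes_saturated y unfolding d by blast
  qed
qed

theorem corollary1p8:
  fixes T :: "'a::metric_space \<Rightarrow> 'a" and d :: nat
  assumes "dynamical_system (euclidean :: 'a topology) T"
    and "1 \<le> d"
  shows "(minimal_system T \<and> distal T \<longrightarrow>
            cubic_characteristic_factor d T
              (pro_nilfactor (d - 1) T) (pro_nilfactor_action T) (pro_nilfactor_map (d - 1) T)) \<and>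
         (minimal_system T \<and> weakly_mixing T \<longrightarrow>
            cubic_characteristic_factor d T
              (discrete_topology {()}) (\<lambda>u. u) (\<lambda>_. ()))"
proof (intro conjI impI; elim conjE)
  assume "minimal_system T" "distal T"
  then interpret minimal_distal_system T
    using assms(1) by unfold_locales
  show "cubic_characteristic_factor d T
      (pro_nilfactor (d - 1) T) (pro_nilfactor_action T) (pro_nilfactor_map (d - 1) T)"
    using assms(2) by (rule pro_nilfactor_characteristic)
next
  assume "weakly_mixing T"
  then interpret weakly_mixing_system T
    using assms(1) by unfold_locales
  show "cubic_characteristic_factor d T (discrete_topology {()}) (\<lambda>u. u) (\<lambda>_. ())"
    by (rule one_point_factor_characteristic)
qed

end
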